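(* Let $T>0$, and let $r,q:\mathbb{R}\times[0,1]\to\mathbb{R}$ be the functions associated, as defined in the context, with a two-state mean field game with running cost $c$. Let $w:[0,1]\times[0,T]\to\mathbb{R}$ be a smooth solution of $$-w_t(\zeta,t)+r(w(\zeta,t),\zeta)\,\partial_\zeta w(\zeta,t)=q(w(\zeta,t),\zeta),\qquad \zeta\in[0,1],\ t\in[0,T].$$ Then there exist a time $t_0\in[0,T)$ and a constant $C$, depending only on the $L^\infty$ norm and the Lipschitz constant of the terminal function $\zeta\mapsto w(\zeta,T)$ (the data $T$ and $c$ of the problem being fixed), such that for all $t_0<t\le T$, $$\|\partial_\zeta w(\cdot,t)\|_{L^\infty([0,1])}\le \frac{C}{t-t_0}.$$
   Context: Let $\mathcal I=\{1,2\}$, $\mathcal P(\mathcal I)=\{\theta=(\theta_1,\theta_2)\in\mathbb{R}^2:\theta_1+\theta_2=1,\ \theta_i\ge 0\}$ and $\mathbb{R}_0^+=[0,\infty)$. Running cost. $c:\mathcal I\times\mathcal P(\mathcal I)\times(\mathbb{R}_0^+)^2\to\mathbb{R}$, $(i,\theta,\alpha)\mapsto c(i,\theta,\alpha)$, satisfies: - $c$ is Lipschitz continuous in $\theta$, with Lipschitz constant bounded independently of $\alpha$; - $c$ is differentiable in $\alpha$, and $\frac{\partial c}{\partial\alpha}(i,\theta,\alpha)$ is Lipschitz in $\theta$, uniformly in $\alpha$; - for each $i$, $c(i,\theta,\alpha)$ does not depend on the $i$-th coordinate $\alpha_i$ of $\alpha$; - (uniform convexity) there is $\gamma>0$ such that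 for every $i\in\mathcal I$, with $j\ne i$ the other state, every $\theta\in\mathcal P(\mathcal I)$ and all $\alpha,\alpha'\in(\mathbb{R}_0^+)^2$ with $\alpha_j\neq\alpha_j'$, $$c(i,\theta,\alpha')-c(i,\theta,\alpha)\ge\nabla_\alpha c(i,\theta,\alpha)\cdot(\alpha'-\alpha)+\gamma|\alpha_j'-\alpha_j|^2;$$ - (superlinearity) for $j\neq i$, $c(i,\theta,\alpha)/|\alpha_j|\to\infty$ as $\alpha_j\to\infty$. Derived functions. For $z=(z^1,z^2)\in\mathbb{R}^2$ put $\Delta_i z=(z^1-z^i,z^2-z^i)$. The generalised Legendre transform of $c$ is $$h(z,\theta,i)=\min_{\mu\in(\mathbb{R}_0^+)^2}\big[c(i,\theta,\mu)+\mu\cdot\Delta_i z\big].$$ For $j\ne i$, $\alpha^*_j(z,\theta,i)$ is the $j$-th coordinate of a minimiser $\mu$ in this problem (this coordinate is uniquely determined), and by convention $\alpha^*_i(z,\theta,i)=-\alpha^*_j(z,\theta,i)$, so that $\sum_{k\in\mathcal I}\alpha_k^*(z,\theta,i)=0$. Define $$g_1(z,\theta)=\theta_1\alpha_1^*(z,\theta,1)+\theta_2\alpha_1^*(z,\theta,2).$$ For $w\in\mathbb{R}$ and $\zeta\in[0,1]$, the functions $r$ and $q$ are $$r(w,\zeta)=-g_1\big((w,0),(\zeta,1-\zeta)\big),\qquad q(w,\zeta)=h\big((w,0),(\zeta,1-\zeta),1\big)-h\big((w,0),(\zeta,1-\zeta),2\big).$$ *)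

theory Defs
  imports "HOL-Analysis.Analysis" "HOL-Probability.Essential_Supremum"
begin

definition prob_simplex :: "(real^2) set" where
  "prob_simplex = {\<theta>. \<theta>$1 + \<theta>$2 = 1 \<and> (\<forall>i. 0 \<le> \<theta>$i)}"

definition quadrant :: "(real^2) set" where
  "quadrant = {\<alpha>. \<forall>k. 0 \<le> \<alpha>$k}"

text \<open>States are the elements of the two-element type \<open>2\<close>. A cost is only meaningful on
  \<open>prob_simplex\<close> and \<open>quadrant\<close>; on the faces of the quadrant, derivatives in \<open>\<alpha>\<close> are
  taken within the quadrant, where they are still unique.\<close>

definition grad_cost :: "(2 \<Rightarrow> real^2 \<Rightarrow> real^2 \<Rightarrow> real) \<Rightarrow> 2 \<Rightarrow> real^2 \<Rightarrow> real^2 \<Rightarrow> real^2" where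
  "grad_cost c i \<theta> \<alpha> = (\<chi> k. frechet_derivative (c i \<theta>) (at \<alpha> within quadrant) (axis k 1))"

locale running_cost =
  fixes c :: "2 \<Rightarrow> real^2 \<Rightarrow> real^2 \<Rightarrow> real"
  assumes lipschitz_cost:
    "\<exists>K. \<forall>i. \<forall>\<alpha>\<in>quadrant. K-lipschitz_on prob_simplex (\<lambda>\<theta>. c i \<theta> \<alpha>)"
  and differentiable_cost:
    "\<And>i \<theta> \<alpha>. \<theta> \<in> prob_simplex \<Longrightarrow> \<alpha> \<in> quadrant \<Longrightarrow>
       (c i \<theta>) differentiable (at \<alpha> within quadrant)"
  and lipschitz_grad:
    "\<exists>K. \<forall>i. \<forall>\<alpha>\<in>quadrant. K-lipschitz_on prob_simplex (\<lambda>\<theta>. grad_cost c i \<theta> \<alpha>)"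
  and independent_own_coordinate:
    "\<And>i \<theta> \<alpha> \<alpha>'. \<theta> \<in> prob_simplex \<Longrightarrow> \<alpha> \<in> quadrant \<Longrightarrow> \<alpha>' \<in> quadrant \<Longrightarrow>
       (\<forall>k. k \<noteq> i \<longrightarrow> \<alpha>$k = \<alpha>'$k) \<Longrightarrow> c i \<theta> \<alpha> = c i \<theta> \<alpha>'"
  and uniformly_convex:
    "\<exists>\<gamma>>0. \<forall>i j. j \<noteq> i \<longrightarrow> (\<forall>\<theta>\<in>prob_simplex. \<forall>\<alpha>\<in>quadrant. \<forall>\<alpha>'\<in>quadrant. \<alpha>$j \<noteq> \<alpha>'$j \<longrightarrow>
       c i \<theta> \<alpha>' - c i \<theta> \<alpha> \<ge> grad_cost c i \<theta> \<alpha> \<bullet> (\<alpha>' - \<alpha>) + \<gamma> * \<bar>\<alpha>'$j - \<alpha>$j\<bar>^2)"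
  and superlinear:
    "\<And>i j \<theta>. j \<noteq> i \<Longrightarrow> \<theta> \<in> prob_simplex \<Longrightarrow>
       filterlim (\<lambda>\<alpha>. c i \<theta> \<alpha> / \<bar>\<alpha>$j\<bar>) at_top
         (inf (filtercomap (\<lambda>\<alpha>. \<alpha>$j) at_top) (principal quadrant))"

definition other :: "2 \<Rightarrow> 2" where
  "other i = (if i = 1 then 2 else 1)"

definition Delta :: "2 \<Rightarrow> real^2 \<Rightarrow> real^2" where
  "Delta i z = (\<chi> k. z$k - z$i)"

definition legendre_obj ::
    "(2 \<Rightarrow> real^2 \<Rightarrow> real^2 \<Rightarrow> real) \<Rightarrow> real^2 \<Rightarrow> real^2 \<Rightarrow> 2 \<Rightarrow> real^2 \<Rightarrow> real" where
  "legendre_obj c z \<theta> i \<mu> = c i \<theta> \<mu> + \<mu> \<bullet> Delta i z"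

text \<open>The least element of the set of values, i.e. an attained minimum, not merely an infimum.\<close>

definition legendre_h ::
    "(2 \<Rightarrow> real^2 \<Rightarrow> real^2 \<Rightarrow> real) \<Rightarrow> real^2 \<Rightarrow> real^2 \<Rightarrow> 2 \<Rightarrow> real" where
  "legendre_h c z \<theta> i = (LEAST y. y \<in> legendre_obj c z \<theta> i ` quadrant)"

definition opt_rate ::
    "(2 \<Rightarrow> real^2 \<Rightarrow> real^2 \<Rightarrow> real) \<Rightarrow> real^2 \<Rightarrow> real^2 \<Rightarrow> 2 \<Rightarrow> real" where
  "opt_rate c z \<theta> i =
     (THE a. \<exists>\<mu>. is_arg_min (legendre_obj c z \<theta> i) (\<lambda>\<mu>. \<mu> \<in> quadrant) \<mu> \<and> a = \<mu> $ other i)"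

text \<open>\<open>alpha_star c z \<theta> i k\<close> is the \<open>k\<close>-th coordinate \<open>\<alpha>\<^sup>*\<^sub>k(z, \<theta>, i)\<close>.\<close>

definition alpha_star ::
    "(2 \<Rightarrow> real^2 \<Rightarrow> real^2 \<Rightarrow> real) \<Rightarrow> real^2 \<Rightarrow> real^2 \<Rightarrow> 2 \<Rightarrow> 2 \<Rightarrow> real" where
  "alpha_star c z \<theta> i k = (if k = i then - opt_rate c z \<theta> i else opt_rate c z \<theta> i)"

definition mfg_g1 :: "(2 \<Rightarrow> real^2 \<Rightarrow> real^2 \<Rightarrow> real) \<Rightarrow> real^2 \<Rightarrow> real^2 \<Rightarrow> real" where
  "mfg_g1 c z \<theta> = \<theta>$1 * alpha_star c z \<theta> 1 1 + \<theta>$2 * alpha_star c z \<theta> 2 1"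

definition mfg_r :: "(2 \<Rightarrow> real^2 \<Rightarrow> real^2 \<Rightarrow> real) \<Rightarrow> real \<Rightarrow> real \<Rightarrow> real" where
  "mfg_r c w \<zeta> = - mfg_g1 c (vector [w, 0]) (vector [\<zeta>, 1 - \<zeta>])"

definition mfg_q :: "(2 \<Rightarrow> real^2 \<Rightarrow> real^2 \<Rightarrow> real) \<Rightarrow> real \<Rightarrow> real \<Rightarrow> real" where
  "mfg_q c w \<zeta> = legendre_h c (vector [w, 0]) (vector [\<zeta>, 1 - \<zeta>]) 1
              - legendre_h c (vector [w, 0]) (vector [\<zeta>, 1 - \<zeta>]) 2"

text \<open>Partial derivatives of a function on \<open>[0,1] \<times> [0,T]\<close>, one-sided on the boundary.\<close>

definition d_zeta :: "(real \<Rightarrow> real \<Rightarrow> real) \<Rightarrow> real \<Rightarrow> real \<Rightarrow> real" where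
  "d_zeta w \<zeta> t = vector_derivative (\<lambda>x. w x t) (at \<zeta> within {0..1})"

definition d_time :: "real \<Rightarrow> (real \<Rightarrow> real \<Rightarrow> real) \<Rightarrow> real \<Rightarrow> real \<Rightarrow> real" where
  "d_time T w \<zeta> t = vector_derivative (\<lambda>s. w \<zeta> s) (at t within {0..T})"

definition C1_rect :: "real \<Rightarrow> (real \<Rightarrow> real \<Rightarrow> real) \<Rightarrow> bool" where
  "C1_rect T w \<longleftrightarrow>
     (\<forall>\<zeta>\<in>{0..1}. \<forall>t\<in>{0..T}. (\<lambda>x. w x t) differentiable (at \<zeta> within {0..1}) \<and>
        (\<lambda>s. w \<zeta> s) differentiable (at t within {0..T})) \<and>
     continuous_on ({0..1} \<times> {0..T}) (\<lambda>(\<zeta>, t). d_zeta w \<zeta> t) \<and>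
     continuous_on ({0..1} \<times> {0..T}) (\<lambda>(\<zeta>, t). d_time T w \<zeta> t)"

text \<open>``Smooth solution'' is read as classical (\<open>C\<^sup>1\<close>) solution: \<open>r\<close> and \<open>q\<close> are in general
  only locally Lipschitz, so no higher regularity of \<open>w\<close> is to be expected.\<close>

definition smooth_solution ::
    "(2 \<Rightarrow> real^2 \<Rightarrow> real^2 \<Rightarrow> real) \<Rightarrow> real \<Rightarrow> (real \<Rightarrow> real \<Rightarrow> real) \<Rightarrow> bool" where
  "smooth_solution c T w \<longleftrightarrow> C1_rect T w \<and>
     (\<forall>\<zeta>\<in>{0..1}. \<forall>t\<in>{0..T}.
        - d_time T w \<zeta> t + mfg_r c (w \<zeta> t) \<zeta> * d_zeta w \<zeta> t = mfg_q c (w \<zeta> t) \<zeta>)"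

definition Linf_norm :: "(real \<Rightarrow> real) \<Rightarrow> ereal" where
  "Linf_norm f = esssup (lebesgue_on {0..1}) (\<lambda>x. ereal \<bar>f x\<bar>)"

text \<open>The least Lipschitz constant; meaningful for functions that are Lipschitz on \<open>[0,1]\<close>.\<close>

definition lipschitz_const :: "(real \<Rightarrow> real) \<Rightarrow> real" where
  "lipschitz_const f = Inf {L. L-lipschitz_on {0..1} f}"

end

theory Submission
  imports Defs
begin

text \<open>Since \<open>t0\<close> may be chosen close to \<open>T\<close>, it suffices to bound the
  gradient on a short interval \<open>[T - \<delta>, T]\<close> with \<open>\<delta>\<close> depending only on the terminal data.
  Uniform convexity makes the minimisers in the Legendre transform Lipschitz in \<open>(w, \<zeta>)\<close>, hence
  \<open>r\<close> and \<open>q\<close> are locally Lipschitz; moreover \<open>r(\<cdot>, 0) \<le> 0 \<le> r(\<cdot>, 1)\<close>, i.e. characteristics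
  followed forward in time stay in \<open>[0,1]\<close>. Comparing \<open>w\<close>, and then the increment
  \<open>w x t - w y t\<close>, with barriers affine in \<open>t\<close> at the last touching time gives first a sup
  bound and then a Lipschitz bound, as long as the Riccati inequality \<open>- K' > A * (1 + K)\<^sup>2\<close> for
  the Lipschitz constant \<open>K\<close> has a bounded solution.\<close>

section \<open>A maximum principle for the transport equation\<close>

text \<open>A positive derivative would force larger values just to the right of \<open>x\<close>.
  Only one side is compared, so the test also serves at endpoints of [0,1] and for maxima over later
  times.\<close>

lemma deriv_le_0_if_max_right:
  fixes f :: "real \<Rightarrow> real"
  assumes D: "(f has_real_derivative D) (at x within S)"
    and "x < b" "{x..b} \<subseteq> S" "\<And>y. x \<le> y \<Longrightarrow> y \<le> b \<Longrightarrow> f y \<le> f x"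
  shows "D \<le> 0"
proof (rule ccontr)
  assume "\<not> D \<le> 0"
  then obtain d where d: "d > 0" "\<And>h. h > 0 \<Longrightarrow> x + h \<in> S \<Longrightarrow> h < d \<Longrightarrow> f x < f (x + h)"
    using has_real_derivative_pos_inc_right[OF D] by force
  define h where "h = min (d / 2) (b - x)"
  have h: "h > 0" "h < d" "x + h \<le> b" using d(1) assms(2) by (auto simp: h_def)
  then have "f x < f (x + h)" using d(2)[of h] subsetD[OF assms(3), of "x + h"] by simp
  moreover have "f (x + h) \<le> f x" using assms(4)[of "x + h"] h by simp
  ultimately show False by simp
qed

lemma deriv_ge_0_if_max_left:
  fixes f :: "real \<Rightarrow> real"
  assumes D: "(f has_real_derivative D) (at x within S)"
    and "b < x" "{b..x} \<subseteq> S" "\<And>y. b \<le> y \<Longrightarrow> y \<le> x \<Longrightarrow> f y \<le> f x"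
  shows "D \<ge> 0"
proof (rule ccontr)
  assume "\<not> D \<ge> 0"
  then obtain d where d: "d > 0" "\<And>h. h > 0 \<Longrightarrow> x - h \<in> S \<Longrightarrow> h < d \<Longrightarrow> f x < f (x - h)"
    using has_real_derivative_neg_dec_left[OF D] by force
  define h where "h = min (d / 2) (x - b)"
  have h: "h > 0" "h < d" "b \<le> x - h" using d(1) assms(2) by (auto simp: h_def)
  then have "f x < f (x - h)" using d(2)[of h] subsetD[OF assms(3), of "x - h"] by simp
  moreover have "f (x - h) \<le> f x" using assms(4)[of "x - h"] h by simp
  ultimately show False by simp
qed

text \<open>The compact set where \<open>\<Phi>\<close> is nonnegative has a point of largest time,
  and this time is below \<open>T\<close> by \<open>neg\<close>. Such a point is both a spatial
  maximum and a maximum over later times, which is what a barrier argument backwards from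
  \<open>T\<close> needs.\<close>

lemma last_touching_time:
  fixes \<Phi> :: "'a::metric_space \<Rightarrow> real \<Rightarrow> real"
  assumes "compact X" and cont: "continuous_on (X \<times> {a..T}) (\<lambda>(p, t). \<Phi> p t)"
    and neg: "\<And>p. p \<in> X \<Longrightarrow> \<Phi> p T < 0"
    and ex: "p0 \<in> X" "t0 \<in> {a..T}" "\<Phi> p0 t0 \<ge> 0"
  obtains p t where "p \<in> X" "t \<in> {a..<T}" "\<Phi> p t = 0" "\<And>p'. p' \<in> X \<Longrightarrow> \<Phi> p' t \<le> 0"
    "\<And>s. s \<in> {t..T} \<Longrightarrow> \<Phi> p s \<le> 0"
proof -
  let ?D = "X \<times> {a..T}"
  define S where "S = {z \<in> ?D. 0 \<le> (\<lambda>(p, t). \<Phi> p t) z}"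
  have cD: "compact ?D" using assms(1) by (intro compact_Times) auto
  have "closedin (top_of_set ?D) S"
    using continuous_closedin_preimage[OF cont, of "{0..}"] unfolding S_def
    by (simp add: vimage_def Int_def)
  then have cS: "compact S" using cD closedin_compact by blast
  have neS: "S \<noteq> {}" using ex by (auto simp: S_def)
  obtain z where z: "z \<in> S" "\<And>y. y \<in> S \<Longrightarrow> snd y \<le> snd z"
    using continuous_attains_sup[OF cS neS continuous_on_snd[OF continuous_on_id]] by blast
  obtain p t where pt: "z = (p, t)" by force
  have p: "p \<in> X" "t \<in> {a..T}" "\<Phi> p t \<ge> 0" using z(1) by (auto simp: S_def pt)
  have late: "\<Phi> p' s < 0" if "p' \<in> X" "s \<in> {t<..T}" for p' s
  proof (rule ccontr)
    assume "\<not> ?thesis"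
    then have "(p', s) \<in> S" using that p by (auto simp: S_def)
    then show False using z(2)[of "(p', s)"] that by (simp add: pt)
  qed
  have tT: "t < T" using p neg[of p] by (cases "t = T") auto
  \<comment> \<open>At time \<open>t\<close> itself the sign is the limit of the strict inequalities
    \<open>late\<close> as \<open>s\<close> decreases to \<open>t\<close>.\<close>
  have le: "\<Phi> p' t \<le> 0" if p': "p' \<in> X" for p'
  proof -
    have "continuous_on {t..T} (\<lambda>s. (\<lambda>(p, t). \<Phi> p t) (p', s))"
      by (rule continuous_on_compose2[OF cont]) (use p' p in \<open>auto intro!: continuous_intros\<close>)
    then have "((\<lambda>s. \<Phi> p' s) \<longlongrightarrow> \<Phi> p' t) (at t within {t..T})"
      using tT by (auto simp: continuous_on)
    then have l: "((\<lambda>s. \<Phi> p' s) \<longlongrightarrow> \<Phi> p' t) (at_right t)"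
      using tT by (simp add: at_within_Icc_at_right)
    have "eventually (\<lambda>s. \<Phi> p' s \<le> 0) (at_right t)"
      using eventually_at_right_less[of t] eventually_at_right_real[OF tT]
      by eventually_elim (use late[OF p'] in \<open>fastforce\<close>)
    then show ?thesis by (rule tendsto_upperbound[OF l]) simp
  qed
  show ?thesis
  proof (rule that[of p t])
    show "\<Phi> p t = 0" using p le[of p] by simp
    show "\<Phi> p s \<le> 0" if "s \<in> {t..T}" for s
      using late[of p s] le[of p] p that by (cases "s = t") auto
  qed (use p tT le in auto)
qed

text \<open>The sign conditions \<open>r_0\<close> and \<open>r_1\<close> stand in for boundary data
  at 0 and 1. Keeping \<open>r\<close> and \<open>q\<close> abstract lets every estimate be applied
  to \<open>- w\<close> as well.\<close>

locale transport_equation =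
  fixes a T :: real and r q w wz wt :: "real \<Rightarrow> real \<Rightarrow> real"
  assumes cont: "continuous_on ({0..1} \<times> {a..T}) (\<lambda>(x, t). w x t)"
    and dz: "\<And>x t. x \<in> {0..1} \<Longrightarrow> t \<in> {a..T} \<Longrightarrow>
      ((\<lambda>x. w x t) has_real_derivative wz x t) (at x within {0..1})"
    and dt: "\<And>x t. x \<in> {0..1} \<Longrightarrow> t \<in> {a..T} \<Longrightarrow>
      ((\<lambda>s. w x s) has_real_derivative wt x t) (at t within {a..T})"
    and pde: "\<And>x t. x \<in> {0..1} \<Longrightarrow> t \<in> {a..T} \<Longrightarrow>
      wt x t = r (w x t) x * wz x t - q (w x t) x"
    and r_0: "\<And>u. r u 0 \<le> 0" and r_1: "\<And>u. r u 1 \<ge> 0"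
begin

text \<open>This symmetry turns upper bounds for \<open>w\<close> and its slope into lower bounds.
  Space is not reflected, so the sign conditions on \<open>r\<close> stay at the same
  endpoints.\<close>

lemma transport_equation_uminus:
  "transport_equation a T (\<lambda>u. r (- u)) (\<lambda>u x. - q (- u) x)
     (\<lambda>x t. - w x t) (\<lambda>x t. - wz x t) (\<lambda>x t. - wt x t)"
proof
  show "continuous_on ({0..1} \<times> {a..T}) (\<lambda>(x, t). - w x t)"
    using continuous_on_minus[OF cont] by (simp add: case_prod_unfold)
  show "- wt x t = r (- (- w x t)) x * - wz x t - - q (- (- w x t)) x"
    if "x \<in> {0..1}" "t \<in> {a..T}" for x t
    using pde[OF that] by simp
qed (use r_0 r_1 in \<open>auto intro!: DERIV_minus dz dt\<close>)

text \<open>At a spatial maximum the transport term is nonnegative, so \<open>w\<close> grows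
  backwards in time at rate at most \<open>Q\<close> there. A barrier growing at rate
  \<open>Q + 1\<close> can therefore never be touched.\<close>

lemma upper_bound:
  assumes "\<And>x. x \<in> {0..1} \<Longrightarrow> w x T \<le> M"
    and Q: "\<And>u x. M \<le> u \<Longrightarrow> u \<le> M + 2 \<Longrightarrow> x \<in> {0..1} \<Longrightarrow> \<bar>q u x\<bar> \<le> Q"
    and small: "(Q + 1) * (T - a) \<le> 1" and "Q \<ge> 0"
    and x: "x \<in> {0..1}" and t: "t \<in> {a..T}"
  shows "w x t \<le> M + 2"
proof -
  \<comment> \<open>The offset 1 makes the inequality strict at \<open>T\<close>;
    \<open>small\<close> keeps the barrier below \<open>M + 2\<close>, inside the range where
    \<open>Q\<close> bounds \<open>q\<close>.\<close>
  define B where "B t = M + 1 + (Q + 1) * (T - t)" for t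
  have B: "M + 1 \<le> B t" "B t \<le> M + 2" if "t \<in> {a..T}" for t
  proof -
    show "M + 1 \<le> B t" using that \<open>Q \<ge> 0\<close> by (simp add: B_def)
    have "(Q + 1) * (T - t) \<le> (Q + 1) * (T - a)"
      using that \<open>Q \<ge> 0\<close> by (intro mult_left_mono) auto
    then show "B t \<le> M + 2" using small by (simp add: B_def)
  qed
  have dB: "(B has_real_derivative - (Q + 1)) (at t within S)" for t S
    unfolding B_def by (auto intro!: derivative_eq_intros)
  have "w x t - B t < 0"
  proof (rule ccontr)
    assume "\<not> ?thesis"
    then have ge: "w x t - B t \<ge> 0" by simp
    have "continuous_on ({0..1} \<times> {a..T}) (\<lambda>z. (\<lambda>(x, t). w x t) z - B (snd z))"
      unfolding B_def by (intro continuous_intros cont)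
    then have c: "continuous_on ({0..1} \<times> {a..T}) (\<lambda>(x, t). w x t - B t)"
      by (simp add: case_prod_unfold)
    have n: "w x T - B T < 0" if "x \<in> {0..1}" for x
      using assms(1)[OF that] by (simp add: B_def)
    obtain p s where p: "p \<in> {0..1}" and s: "s \<in> {a..<T}" and 0: "w p s - B s = 0"
      and space: "\<And>p'. p' \<in> {0..1} \<Longrightarrow> w p' s - B s \<le> 0"
      and time: "\<And>s'. s' \<in> {s..T} \<Longrightarrow> w p s' - B s' \<le> 0"
      using last_touching_time[OF compact_Icc c n x t ge] by metis
    have s': "s \<in> {a..T}" using s by auto
    have max: "w y s \<le> w p s" if "y \<in> {0..1}" for y using space[OF that] 0 by simp
    have right: "wz p s \<le> 0" if "p < 1"
      by (rule deriv_le_0_if_max_right[OF dz[OF p s'] that]) (use p max in auto)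
    have left: "wz p s \<ge> 0" if "0 < p"
      by (rule deriv_ge_0_if_max_left[OF dz[OF p s'] that]) (use p max in auto)
    \<comment> \<open>In the interior the slope vanishes. At 0 slope and \<open>r\<close> are both
      nonpositive, at 1 both nonnegative.\<close>
    have rz: "r (w p s) p * wz p s \<ge> 0"
      using right left p r_0 r_1 by (cases "p = 0"; cases "p = 1") (auto simp: mult_nonpos_nonpos)
    have "((\<lambda>s. w p s - B s) has_real_derivative wt p s - - (Q + 1)) (at s within {a..T})"
      by (intro DERIV_diff dt p s' dB)
    then have "wt p s - - (Q + 1) \<le> 0"
      by (rule deriv_le_0_if_max_right[where b = T]) (use s 0 time in auto)
    moreover have "\<bar>q (w p s) p\<bar> \<le> Q" using Q B[OF s'] 0 p by auto
    ultimately show False using pde[OF p s'] rz by linarith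
  qed
  then show ?thesis using B[OF t] by simp
qed

lemma abs_bound:
  assumes M: "\<And>x. x \<in> {0..1} \<Longrightarrow> \<bar>w x T\<bar> \<le> M" "M \<ge> 0"
    and Q: "\<And>u x. \<bar>u\<bar> \<le> M + 2 \<Longrightarrow> x \<in> {0..1} \<Longrightarrow> \<bar>q u x\<bar> \<le> Q"
    and small: "(Q + 1) * (T - a) \<le> 1" and "Q \<ge> 0"
    and x: "x \<in> {0..1}" and t: "t \<in> {a..T}"
  shows "\<bar>w x t\<bar> \<le> M + 2"
proof -
  have "w x t \<le> M + 2"
  proof (rule upper_bound[OF _ _ small \<open>Q \<ge> 0\<close> x t])
    show "w x T \<le> M" if "x \<in> {0..1}" for x using M(1)[OF that] by simp
    show "\<bar>q u x\<bar> \<le> Q" if "M \<le> u" "u \<le> M + 2" "x \<in> {0..1}" for u x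
      using Q[of u x] that M(2) by simp
  qed
  moreover have "- w x t \<le> M + 2"
  proof (rule transport_equation.upper_bound[OF transport_equation_uminus _ _ small \<open>Q \<ge> 0\<close> x t])
    show "- w x T \<le> M" if "x \<in> {0..1}" for x using M(1)[OF that] by simp
    show "\<bar>- q (- u) x\<bar> \<le> Q" if "M \<le> u" "u \<le> M + 2" "x \<in> {0..1}" for u x
      using Q[of "- u" x] that M(2) by simp
  qed
  ultimately show ?thesis by linarith
qed

text \<open>Doubling of variables: \<open>\<epsilon>\<close> keeps the last touching point of \<open>w x t - w y t\<close> and the
  barrier \<open>(L + 1 + P * (T - t)) * (x - y + \<epsilon>)\<close> away from the diagonal.\<close>

lemma increment_less:
  assumes R: "\<And>x t. x \<in> {0..1} \<Longrightarrow> t \<in> {a..T} \<Longrightarrow> \<bar>w x t\<bar> \<le> R"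
    and lip: "\<And>u v x y. \<lbrakk>\<bar>u\<bar> \<le> R; \<bar>v\<bar> \<le> R; x \<in> {0..1}; y \<in> {0..1}\<rbrakk> \<Longrightarrow>
        \<bar>r u x - r v y\<bar> \<le> A * (\<bar>u - v\<bar> + \<bar>x - y\<bar>) \<and> \<bar>q u x - q v y\<bar> \<le> A * (\<bar>u - v\<bar> + \<bar>x - y\<bar>)"
    and L: "\<And>x y. x \<in> {0..1} \<Longrightarrow> y \<in> {0..1} \<Longrightarrow> \<bar>w x T - w y T\<bar> \<le> L * \<bar>x - y\<bar>"
    and pos: "L \<ge> 0" "A \<ge> 0" "\<epsilon> > 0"
    and P: "A * (L + 3)\<^sup>2 < P" "P * (T - a) \<le> 1"
    and xy: "0 \<le> y" "y \<le> x" "x \<le> 1" and t: "t \<in> {a..T}"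
  shows "w x t - w y t < (L + 2) * (x - y + \<epsilon>)"
proof -
  \<comment> \<open>The slope of the barrier starts strictly above \<open>L\<close> and gains at
    most 1 over the whole interval, since \<open>P * (T - a) \<le> 1\<close>.\<close>
  define K where "K t = L + 1 + P * (T - t)" for t
  \<comment> \<open>On this triangle of ordered pairs the barrier needs no absolute value and is
    smooth.\<close>
  define X where "X = {z :: real \<times> real. 0 \<le> snd z \<and> snd z \<le> fst z \<and> fst z \<le> 1}"
  define \<Phi> where "\<Phi> z t = w (fst z) t - w (snd z) t - K t * (fst z - snd z + \<epsilon>)" for z t
  have "A * (L + 3)\<^sup>2 \<ge> 0" using pos by simp
  then have P0: "P > 0" using P by simp
  have K: "L + 1 \<le> K t" "K t \<le> L + 2" if "t \<in> {a..T}" for t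
  proof -
    show "L + 1 \<le> K t" using that P0 by (simp add: K_def)
    have "P * (T - t) \<le> P * (T - a)" using that P0 by (intro mult_left_mono) auto
    then show "K t \<le> L + 2" using P by (simp add: K_def)
  qed
  have dK: "(K has_real_derivative - P) (at t within S)" for t S
    unfolding K_def by (auto intro!: derivative_eq_intros)
  have X_unit: "fst z \<in> {0..1}" "snd z \<in> {0..1}" if "z \<in> X" for z using that by (auto simp: X_def)
  have "X = ({0..1} \<times> {0..1}) \<inter> {z. snd z \<le> fst z}" by (auto simp: X_def)
  moreover have "closed {z :: real \<times> real. snd z \<le> fst z}" by (intro closed_Collect_le continuous_intros)
  ultimately have cX: "compact X" by (simp add: compact_Int_closed compact_Times)
  have "\<Phi> (x, y) t < 0"
  proof (rule ccontr)
    assume "\<not> ?thesis"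
    then have ge: "\<Phi> (x, y) t \<ge> 0" by simp
    have c1: "continuous_on (X \<times> {a..T}) (\<lambda>z. (\<lambda>(x, t). w x t) (fst (fst z), snd z))"
      by (rule continuous_on_compose2[OF cont]) (auto intro!: continuous_intros dest: X_unit)
    have c2: "continuous_on (X \<times> {a..T}) (\<lambda>z. (\<lambda>(x, t). w x t) (snd (fst z), snd z))"
      by (rule continuous_on_compose2[OF cont]) (auto intro!: continuous_intros dest: X_unit)
    have "continuous_on (X \<times> {a..T}) (\<lambda>z. (\<lambda>(x, t). w x t) (fst (fst z), snd z)
        - (\<lambda>(x, t). w x t) (snd (fst z), snd z) - K (snd z) * (fst (fst z) - snd (fst z) + \<epsilon>))"
      unfolding K_def by (intro continuous_intros c1 c2)
    then have c: "continuous_on (X \<times> {a..T}) (\<lambda>(p, t). \<Phi> p t)"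
      by (simp add: \<Phi>_def case_prod_unfold)
    have n: "\<Phi> p T < 0" if "p \<in> X" for p
    proof -
      have "w (fst p) T - w (snd p) T \<le> L * (fst p - snd p)"
        using L[OF X_unit[OF that]] that by (auto simp: X_def)
      also have "\<dots> \<le> (L + 1) * (fst p - snd p)"
        using that by (intro mult_right_mono) (auto simp: X_def)
      also have "\<dots> < (L + 1) * (fst p - snd p + \<epsilon>)" using pos by simp
      finally show ?thesis by (simp add: \<Phi>_def K_def)
    qed
    have xyX: "(x, y) \<in> X" using xy by (simp add: X_def)
    obtain p s where pX: "p \<in> X" and s: "s \<in> {a..<T}" and p0: "\<Phi> p s = 0"
      and space: "\<And>p'. p' \<in> X \<Longrightarrow> \<Phi> p' s \<le> 0"
      and time: "\<And>s'. s' \<in> {s..T} \<Longrightarrow> \<Phi> p s' \<le> 0"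
      using last_touching_time[OF cX c n xyX t ge] by metis
    obtain \<xi> \<eta> where p: "p = (\<xi>, \<eta>)" by force
    have s': "s \<in> {a..T}" using s by auto
    have u: "\<xi> \<in> {0..1}" "\<eta> \<in> {0..1}" "\<eta> \<le> \<xi>" using pX by (auto simp: p X_def)
    have eq: "w \<xi> s - w \<eta> s = K s * (\<xi> - \<eta> + \<epsilon>)" using p0 by (simp add: p \<Phi>_def)
    \<comment> \<open>On the diagonal the increment is 0 while the barrier equals
      \<open>K s * \<epsilon>\<close>, so touching happens off the diagonal.\<close>
    have "K s * \<epsilon> > 0" using K[OF s'] pos by simp
    then have lt: "\<eta> < \<xi>" using u(3) eq by (cases "\<eta> = \<xi>") auto
    have max: "w \<xi>' s - w \<eta>' s - K s * (\<xi>' - \<eta>' + \<epsilon>) \<le> 0" if "0 \<le> \<eta>'" "\<eta>' \<le> \<xi>'" "\<xi>' \<le> 1" for \<xi>' \<eta>'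
      using space[of "(\<xi>', \<eta>')"] that by (simp add: \<Phi>_def X_def)
    \<comment> \<open>Freezing one of the two points turns the maximum over the triangle into a
      maximum in a single variable.\<close>
    have max\<xi>: "w x s - K s * x \<le> w \<xi> s - K s * \<xi>" if "\<eta> \<le> x" "x \<le> 1" for x
      using max[of \<eta> x] that u eq by (simp add: algebra_simps)
    have max\<eta>: "K s * x - w x s \<le> K s * \<eta> - w \<eta> s" if "0 \<le> x" "x \<le> \<xi>" for x
      using max[of x \<xi>] that u eq by (simp add: algebra_simps)
    have d\<xi>: "((\<lambda>x. w x s - K s * x) has_real_derivative wz \<xi> s - K s) (at \<xi> within {0..1})"
      using dz[OF u(1) s'] by (auto intro!: derivative_eq_intros)
    have d\<eta>: "((\<lambda>x. K s * x - w x s) has_real_derivative K s - wz \<eta> s) (at \<eta> within {0..1})"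
      using dz[OF u(2) s'] by (auto intro!: derivative_eq_intros)
    \<comment> \<open>As \<open>\<eta> < \<xi>\<close>, \<open>\<xi>\<close> can always be
      approached from the left. For \<open>\<xi> < 1\<close> the other side is available too and the
      slope equals \<open>K s\<close>; at 1 the sign of \<open>r\<close> decides. The situation at
      \<open>\<eta>\<close> is the mirror image.\<close>
    have "wz \<xi> s - K s \<ge> 0"
      by (rule deriv_ge_0_if_max_left[OF d\<xi> lt]) (use u max\<xi> in auto)
    moreover have "wz \<xi> s - K s \<le> 0" if "\<xi> < 1"
      by (rule deriv_le_0_if_max_right[OF d\<xi> that]) (use u max\<xi> in auto)
    ultimately have "r (w \<xi> s) \<xi> * (wz \<xi> s - K s) \<ge> 0"
      using u r_1 by (cases "\<xi> = 1") auto
    have "K s - wz \<eta> s \<le> 0"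
      by (rule deriv_le_0_if_max_right[OF d\<eta> lt]) (use u max\<eta> in auto)
    moreover have "K s - wz \<eta> s \<ge> 0" if "0 < \<eta>"
      by (rule deriv_ge_0_if_max_left[OF d\<eta> that]) (use u max\<eta> in auto)
    ultimately have "r (w \<eta> s) \<eta> * (K s - wz \<eta> s) \<ge> 0"
      using u r_0[of "w \<eta> s"] by (cases "\<eta> = 0") (auto intro!: mult_nonpos_nonpos)
    note rr = \<open>r (w \<xi> s) \<xi> * (wz \<xi> s - K s) \<ge> 0\<close> this
    have "((\<lambda>s. w \<xi> s - w \<eta> s - K s * (\<xi> - \<eta> + \<epsilon>)) has_real_derivative
        wt \<xi> s - wt \<eta> s - (- P) * (\<xi> - \<eta> + \<epsilon>)) (at s within {a..T})"
      using u by (intro DERIV_diff dt s' DERIV_cmult_right dK)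
    then have tm: "wt \<xi> s - wt \<eta> s - (- P) * (\<xi> - \<eta> + \<epsilon>) \<le> 0"
      by (rule deriv_le_0_if_max_right[where b = T])
        (use s eq time in \<open>auto simp: \<Phi>_def p\<close>)
    let ?d = "\<bar>w \<xi> s - w \<eta> s\<bar> + \<bar>\<xi> - \<eta>\<bar>"
    have lr: "\<bar>r (w \<xi> s) \<xi> - r (w \<eta> s) \<eta>\<bar> \<le> A * ?d" and lq: "\<bar>q (w \<xi> s) \<xi> - q (w \<eta> s) \<eta>\<bar> \<le> A * ?d"
      using lip R s' u by blast+
    have K0: "K s \<ge> 0" using K[OF s'] pos by simp
    have "K s * (r (w \<xi> s) \<xi> - r (w \<eta> s) \<eta>) \<ge> K s * (- (A * ?d))"
      using lr K0 by (intro mult_left_mono) auto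
    \<comment> \<open>Subtract the equations at the two points and replace both slopes by
      \<open>K s\<close>; the errors are the two nonnegative products in \<open>rr\<close>.\<close>
    moreover have "wt \<xi> s - wt \<eta> s \<ge> K s * (r (w \<xi> s) \<xi> - r (w \<eta> s) \<eta>) - (q (w \<xi> s) \<xi> - q (w \<eta> s) \<eta>)"
      using rr pde[OF u(1) s'] pde[OF u(2) s'] by (simp add: algebra_simps)
    ultimately have "wt \<xi> s - wt \<eta> s \<ge> - (A * ((K s + 1) * ?d))"
      using lq by (simp add: algebra_simps abs_le_iff)
    \<comment> \<open>One factor \<open>K s + 1\<close> comes from the terms in \<open>r\<close> and
      \<open>q\<close>, the other from bounding \<open>?d\<close> at the touching point. Their
      product is the quadratic Riccati term.\<close>
    moreover have "A * ((K s + 1) * ?d) \<le> A * ((L + 3)\<^sup>2 * (\<xi> - \<eta> + \<epsilon>))"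
    proof -
      have "K s * (\<xi> - \<eta> + \<epsilon>) \<ge> 0" using K0 lt pos by simp
      then have "?d \<le> (K s + 1) * (\<xi> - \<eta> + \<epsilon>)"
        using lt pos by (simp add: eq distrib_right)
      then have "(K s + 1) * ?d \<le> (K s + 1) * ((K s + 1) * (\<xi> - \<eta> + \<epsilon>))"
        using K0 by (intro mult_left_mono) auto
      also have "\<dots> = (K s + 1)\<^sup>2 * (\<xi> - \<eta> + \<epsilon>)"
        by (simp add: power2_eq_square mult.assoc)
      also have "\<dots> \<le> (L + 3)\<^sup>2 * (\<xi> - \<eta> + \<epsilon>)"
        using K[OF s'] K0 lt pos by (intro mult_right_mono power_mono) auto
      finally show ?thesis using pos by (intro mult_left_mono) auto
    qed
    \<comment> \<open>The time maximum \<open>tm\<close> asks for a decrease at rate at least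
      \<open>P\<close>, more than the equation permits.\<close>
    moreover have "A * (L + 3)\<^sup>2 * (\<xi> - \<eta> + \<epsilon>) < P * (\<xi> - \<eta> + \<epsilon>)"
      using P lt pos by (intro mult_strict_right_mono) auto
    ultimately show False using tm by (simp add: mult.assoc)
  qed
  then have "w x t - w y t < K t * (x - y + \<epsilon>)" by (simp add: \<Phi>_def)
  also have "\<dots> \<le> (L + 2) * (x - y + \<epsilon>)" using K[OF t] xy pos by (intro mult_right_mono) auto
  finally show ?thesis .
qed

text \<open>Letting \<epsilon> tend to 0 in the increment estimate shows that
  \<open>w x t - (L + 2) * x\<close> is nonincreasing in \<open>x\<close>.\<close>

lemma slope_le:
  assumes R: "\<And>x t. x \<in> {0..1} \<Longrightarrow> t \<in> {a..T} \<Longrightarrow> \<bar>w x t\<bar> \<le> R"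
    and lip: "\<And>u v x y. \<lbrakk>\<bar>u\<bar> \<le> R; \<bar>v\<bar> \<le> R; x \<in> {0..1}; y \<in> {0..1}\<rbrakk> \<Longrightarrow>
        \<bar>r u x - r v y\<bar> \<le> A * (\<bar>u - v\<bar> + \<bar>x - y\<bar>) \<and> \<bar>q u x - q v y\<bar> \<le> A * (\<bar>u - v\<bar> + \<bar>x - y\<bar>)"
    and L: "\<And>x y. x \<in> {0..1} \<Longrightarrow> y \<in> {0..1} \<Longrightarrow> \<bar>w x T - w y T\<bar> \<le> L * \<bar>x - y\<bar>"
    and pos: "L \<ge> 0" "A \<ge> 0"
    and P: "A * (L + 3)\<^sup>2 < P" "P * (T - a) \<le> 1"
    and x: "x \<in> {0..1}" and t: "t \<in> {a..T}"
  shows "wz x t \<le> L + 2"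
proof -
  have mono: "w x t - (L + 2) * x \<le> w y t - (L + 2) * y" if "0 \<le> y" "y \<le> x" "x \<le> 1" for x y
  proof -
    have "w x t - w y t \<le> (L + 2) * (x - y) + e" if "e > 0" for e
      using increment_less[OF R lip L pos, of "e / (L + 2)" P y x t] P pos t that
        \<open>0 \<le> y\<close> \<open>y \<le> x\<close> \<open>x \<le> 1\<close> by (simp add: distrib_left)
    then have "w x t - w y t \<le> (L + 2) * (x - y)" by (rule field_le_epsilon)
    then show ?thesis by (simp add: right_diff_distrib)
  qed
  have d: "((\<lambda>x. w x t - (L + 2) * x) has_real_derivative wz x t - (L + 2)) (at x within {0..1})"
    using dz[OF x t] by (auto intro!: derivative_eq_intros)
  have "wz x t - (L + 2) \<le> 0"
  \<comment> \<open>At the right endpoint there are no points to compare with on the right, so the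
    left-hand test is applied to the negated function.\<close>
  proof (cases "x < 1")
    case True
    show ?thesis by (rule deriv_le_0_if_max_right[OF d True]) (use x mono in auto)
  next
    case False
    then have x1: "x = 1" using x by simp
    have "- (wz x t - (L + 2)) \<ge> 0"
    proof (rule deriv_ge_0_if_max_left[OF DERIV_minus[OF d], of 0])
      show "- (w y t - (L + 2) * y) \<le> - (w x t - (L + 2) * x)" if "0 \<le> y" "y \<le> x" for y
        using mono[of y x] that x1 by simp
    qed (use x1 in auto)
    then show ?thesis by simp
  qed
  then show ?thesis by simp
qed

lemma abs_slope_le:
  assumes R: "\<And>x t. x \<in> {0..1} \<Longrightarrow> t \<in> {a..T} \<Longrightarrow> \<bar>w x t\<bar> \<le> R"
    and lip: "\<And>u v x y. \<lbrakk>\<bar>u\<bar> \<le> R; \<bar>v\<bar> \<le> R; x \<in> {0..1}; y \<in> {0..1}\<rbrakk> \<Longrightarrow>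
        \<bar>r u x - r v y\<bar> \<le> A * (\<bar>u - v\<bar> + \<bar>x - y\<bar>) \<and> \<bar>q u x - q v y\<bar> \<le> A * (\<bar>u - v\<bar> + \<bar>x - y\<bar>)"
    and L: "\<And>x y. x \<in> {0..1} \<Longrightarrow> y \<in> {0..1} \<Longrightarrow> \<bar>w x T - w y T\<bar> \<le> L * \<bar>x - y\<bar>"
    and pos: "L \<ge> 0" "A \<ge> 0"
    and P: "A * (L + 3)\<^sup>2 < P" "P * (T - a) \<le> 1"
    and x: "x \<in> {0..1}" and t: "t \<in> {a..T}"
  shows "\<bar>wz x t\<bar> \<le> L + 2"
proof -
  have "wz x t \<le> L + 2" by (rule slope_le[OF R lip L pos P x t])
  moreover have "- wz x t \<le> L + 2"
  proof (rule transport_equation.slope_le[OF transport_equation_uminus _ _ _ pos P x t])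
    fix u v x y :: real
    assume "\<bar>u\<bar> \<le> R" "\<bar>v\<bar> \<le> R" "x \<in> {0..1}" "y \<in> {0..1}"
    then show "\<bar>r (- u) x - r (- v) y\<bar> \<le> A * (\<bar>u - v\<bar> + \<bar>x - y\<bar>) \<and>
        \<bar>- q (- u) x - - q (- v) y\<bar> \<le> A * (\<bar>u - v\<bar> + \<bar>x - y\<bar>)"
      using lip[of "- u" "- v" x y] by (simp add: abs_minus_commute)
  qed (use R L in \<open>auto simp: abs_minus_commute\<close>)
  ultimately show ?thesis by linarith
qed

end

section \<open>Lipschitz regularity of the Legendre transform\<close>

text \<open>This models the running cost as a function of the single rate of jumping to the other
  state, with the distribution \<theta> as parameter. Derivatives at rate 0 are one-sided.\<close>

locale convex_family =
  fixes \<Theta> :: "'a::metric_space set" and \<phi> G :: "'a \<Rightarrow> real \<Rightarrow> real" and K \<gamma> :: real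
  assumes deriv: "\<And>\<theta> a. \<theta> \<in> \<Theta> \<Longrightarrow> 0 \<le> a \<Longrightarrow> (\<phi> \<theta> has_real_derivative G \<theta> a) (at a within {0..})"
    and convex: "\<And>\<theta> a b. \<theta> \<in> \<Theta> \<Longrightarrow> 0 \<le> a \<Longrightarrow> 0 \<le> b \<Longrightarrow>
      \<phi> \<theta> b \<ge> \<phi> \<theta> a + G \<theta> a * (b - a) + \<gamma> * (b - a)\<^sup>2"
    and lipschitz: "\<And>\<theta> \<theta>' a. \<theta> \<in> \<Theta> \<Longrightarrow> \<theta>' \<in> \<Theta> \<Longrightarrow> 0 \<le> a \<Longrightarrow> \<bar>\<phi> \<theta> a - \<phi> \<theta>' a\<bar> \<le> K * dist \<theta> \<theta>'"
    and lipschitz_deriv: "\<And>\<theta> \<theta>' a. \<theta> \<in> \<Theta> \<Longrightarrow> \<theta>' \<in> \<Theta> \<Longrightarrow> 0 \<le> a \<Longrightarrow> \<bar>G \<theta> a - G \<theta>' a\<bar> \<le> K * dist \<theta> \<theta>'"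
    and \<gamma>_pos: "\<gamma> > 0"
begin

text \<open>The number \<open>p\<close> plays the role of the potential difference between the other
  state and the current one.\<close>

definition minimiser :: "real \<Rightarrow> 'a \<Rightarrow> real \<Rightarrow> bool" where
  "minimiser p \<theta> a \<longleftrightarrow> 0 \<le> a \<and> (\<forall>b\<ge>0. \<phi> \<theta> a + p * a \<le> \<phi> \<theta> b + p * b)"

text \<open>Uniform convexity at 0 makes the objective coercive, so a minimum over a compact
  interval is global.\<close>

lemma minimiser_exists:
  assumes "\<theta> \<in> \<Theta>"
  shows "\<exists>a. minimiser p \<theta> a"
proof -
  \<comment> \<open>Beyond \<open>B\<close> the term \<open>\<gamma> * b\<^sup>2\<close> outweighs
    the linear one, and the objective is at least its value at 0.\<close>
  define B where "B = \<bar>G \<theta> 0 + p\<bar> / \<gamma>"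
  have B: "B \<ge> 0" using \<gamma>_pos by (simp add: B_def)
  have "continuous_on {0..} (\<phi> \<theta>)"
    using deriv[OF assms] by (intro DERIV_continuous_on) auto
  then have "continuous_on {0..B} (\<lambda>b. \<phi> \<theta> b + p * b)"
    by (intro continuous_intros) (auto elim: continuous_on_subset)
  then obtain a where a: "a \<in> {0..B}" "\<And>b. b \<in> {0..B} \<Longrightarrow> \<phi> \<theta> a + p * a \<le> \<phi> \<theta> b + p * b"
    using continuous_attains_inf[OF compact_Icc _ \<open>continuous_on {0..B} _\<close>] B by auto
  have "\<phi> \<theta> a + p * a \<le> \<phi> \<theta> b + p * b" if b: "b \<ge> 0" for b
  proof (cases "b \<le> B")
    case False
    have "\<bar>G \<theta> 0 + p\<bar> = \<gamma> * B" using \<gamma>_pos by (simp add: B_def)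
    also have "\<dots> \<le> \<gamma> * b" using False \<gamma>_pos by simp
    finally have "0 \<le> (G \<theta> 0 + p + \<gamma> * b) * b" using b by simp
    then have "\<phi> \<theta> 0 + p * 0 \<le> \<phi> \<theta> b + p * b"
      using convex[OF assms _ b, of 0] by (simp add: algebra_simps power2_eq_square)
    then show ?thesis using a(2)[of 0] B by simp
  qed (use a b in auto)
  then show ?thesis using a(1) by (auto simp: minimiser_def)
qed

text \<open>The minimiser may be the endpoint 0, where the derivative need not vanish; hence a
  variational inequality.\<close>

lemma first_order_condition:
  assumes "\<theta> \<in> \<Theta>" "minimiser p \<theta> a" "b \<ge> 0"
  shows "(G \<theta> a + p) * (b - a) \<ge> 0"
proof -
  have a: "0 \<le> a" "\<And>b. b \<ge> 0 \<Longrightarrow> \<phi> \<theta> a + p * a \<le> \<phi> \<theta> b + p * b"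
    using assms(2) by (auto simp: minimiser_def)
  have d: "((\<lambda>b. - (\<phi> \<theta> b + p * b)) has_real_derivative - (G \<theta> a + p)) (at a within {0..})"
    using deriv[OF assms(1) a(1)] by (auto intro!: derivative_eq_intros)
  consider "b = a" | "a < b" | "b < a" by linarith
  then show ?thesis
  proof cases
    case 2
    have "- (G \<theta> a + p) \<le> 0"
    proof (rule deriv_le_0_if_max_right[OF d 2])
      show "- (\<phi> \<theta> y + p * y) \<le> - (\<phi> \<theta> a + p * a)" if "a \<le> y" for y
        using a(2)[of y] a(1) that by simp
    qed (use a in auto)
    then show ?thesis using 2 by simp
  next
    case 3
    have "- (G \<theta> a + p) \<ge> 0"
    proof (rule deriv_ge_0_if_max_left[OF d 3])
      show "- (\<phi> \<theta> y + p * y) \<le> - (\<phi> \<theta> a + p * a)" if "b \<le> y" for y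
        using a(2)[of y] assms(3) that by simp
    qed (use assms(3) in auto)
    then show ?thesis using 3 by (intro mult_nonpos_nonpos) auto
  qed simp
qed

lemma minimiser_lipschitz:
  assumes "\<theta> \<in> \<Theta>" "\<theta>' \<in> \<Theta>" "minimiser p \<theta> a" "minimiser p' \<theta>' b"
  shows "\<bar>a - b\<bar> \<le> (K * dist \<theta> \<theta>' + \<bar>p - p'\<bar>) / (2 * \<gamma>)"
proof (cases "a = b")
  case True
  \<comment> \<open>The sign of \<open>K\<close> is not assumed; that of the product is read off the
    Lipschitz bound at rate 0.\<close>
  have "0 \<le> K * dist \<theta> \<theta>'" using lipschitz[OF assms(1,2) order_refl] by linarith
  then show ?thesis using True \<gamma>_pos by simp
next
  case False
  have a: "0 \<le> a" and b: "0 \<le> b" using assms by (auto simp: minimiser_def)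
  \<comment> \<open>Strong monotonicity of \<open>G \<theta>\<close>: add the convexity inequalities
    based at \<open>a\<close> and at \<open>b\<close>. Next, the two variational inequalities, each
    tested with the other minimiser, remove \<open>G \<theta> a\<close>.\<close>
  have "2 * \<gamma> * (b - a)\<^sup>2 \<le> (G \<theta> b - G \<theta> a) * (b - a)"
    using convex[OF assms(1) a b] convex[OF assms(1) b a]
    by (simp add: algebra_simps power2_commute)
  also have "\<dots> \<le> (G \<theta> b - G \<theta>' b + (p - p')) * (b - a)"
    using first_order_condition[OF assms(1,3) b] first_order_condition[OF assms(2,4) a]
    by (simp add: algebra_simps)
  also have "\<dots> \<le> \<bar>G \<theta> b - G \<theta>' b + (p - p')\<bar> * \<bar>b - a\<bar>"
    by (metis abs_ge_self abs_mult)
  also have "\<dots> \<le> (K * dist \<theta> \<theta>' + \<bar>p - p'\<bar>) * \<bar>b - a\<bar>"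
    using lipschitz_deriv[OF assms(1,2) b] by (intro mult_right_mono) auto
  finally have "(2 * \<gamma> * \<bar>b - a\<bar>) * \<bar>b - a\<bar> \<le> (K * dist \<theta> \<theta>' + \<bar>p - p'\<bar>) * \<bar>b - a\<bar>"
    by (simp add: power2_eq_square)
  then have "2 * \<gamma> * \<bar>b - a\<bar> \<le> K * dist \<theta> \<theta>' + \<bar>p - p'\<bar>"
    using False by simp
  then show ?thesis using \<gamma>_pos by (simp add: field_simps abs_minus_commute)
qed

text \<open>The minimiser \<open>b\<close> of the second problem is a competitor in the first. The
  reverse estimate follows by exchanging the problems.\<close>

lemma minimum_diff_le:
  assumes "\<theta> \<in> \<Theta>" "\<theta>' \<in> \<Theta>" "minimiser p \<theta> a" "minimiser p' \<theta>' b"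
  shows "\<phi> \<theta> a + p * a - (\<phi> \<theta>' b + p' * b) \<le> K * dist \<theta> \<theta>' + \<bar>p - p'\<bar> * b"
proof -
  have b: "0 \<le> b" using assms by (auto simp: minimiser_def)
  have "\<phi> \<theta> a + p * a \<le> \<phi> \<theta> b + p * b" using assms(3) b by (auto simp: minimiser_def)
  also have "\<dots> = \<phi> \<theta>' b + p' * b + (\<phi> \<theta> b - \<phi> \<theta>' b) + (p - p') * b" by (simp add: algebra_simps)
  also have "\<dots> \<le> \<phi> \<theta>' b + p' * b + K * dist \<theta> \<theta>' + \<bar>p - p'\<bar> * b"
    using lipschitz[OF assms(1,2) b] b by (intro add_mono mult_right_mono) auto
  finally show ?thesis by simp
qed

end

section \<open>Reduction of the cost to one real variable\<close>

lemma other_neq [simp]: "other i \<noteq> i"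
  by (simp add: other_def)

lemma eq_other_iff: "k \<noteq> i \<longleftrightarrow> k = other i" for i k :: 2
  using exhaust_2[of i] exhaust_2[of k] by (auto simp: other_def)

lemma axis_in_quadrant: "0 \<le> a \<Longrightarrow> axis j a \<in> quadrant"
  by (auto simp: quadrant_def axis_def)

text \<open>The own coordinate, on which the cost does not depend, is set to 0.\<close>

definition state_cost :: "(2 \<Rightarrow> real^2 \<Rightarrow> real^2 \<Rightarrow> real) \<Rightarrow> 2 \<Rightarrow> real^2 \<Rightarrow> real \<Rightarrow> real" where
  "state_cost c i \<theta> a = c i \<theta> (axis (other i) a)"

definition state_cost_deriv :: "(2 \<Rightarrow> real^2 \<Rightarrow> real^2 \<Rightarrow> real) \<Rightarrow> 2 \<Rightarrow> real^2 \<Rightarrow> real \<Rightarrow> real" where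
  "state_cost_deriv c i \<theta> a = grad_cost c i \<theta> (axis (other i) a) $ other i"

context running_cost
begin

text \<open>Chain rule along the linear embedding of the half-line as an edge of the quadrant, where
  derivatives within the quadrant restrict to derivatives within the half-line.\<close>

lemma state_cost_has_derivative:
  assumes \<theta>: "\<theta> \<in> prob_simplex" and a: "0 \<le> a"
  shows "(state_cost c i \<theta> has_real_derivative state_cost_deriv c i \<theta> a) (at a within {0..})"
proof -
  let ?j = "other i"
  define f' where "f' = frechet_derivative (c i \<theta>) (at (axis ?j a) within quadrant)"
  have f': "(c i \<theta> has_derivative f') (at (axis ?j a) within quadrant)"
    using differentiable_cost[OF \<theta> axis_in_quadrant[OF a]]
    unfolding f'_def by (simp add: frechet_derivative_works)
  have ax: "axis ?j h = h *\<^sub>R axis ?j (1::real)" for h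
    by (simp add: vec_eq_iff axis_def)
  have "bounded_linear (\<lambda>h. axis ?j h :: real^2)"
    by (subst ax) (rule bounded_linear_scaleR_left)
  then have d: "((\<lambda>h. axis ?j h :: real^2) has_derivative (\<lambda>h. axis ?j h)) (at a within {0..})"
    by (rule bounded_linear_imp_has_derivative)
  have "(c i \<theta> has_derivative f') (at (axis ?j a) within (\<lambda>h. axis ?j h) ` {0..})"
    by (rule has_derivative_subset[OF f']) (auto simp: axis_in_quadrant)
  from diff_chain_within[OF d this]
  have "(state_cost c i \<theta> has_derivative (\<lambda>h. f' (axis ?j h))) (at a within {0..})"
    by (simp add: o_def state_cost_def[abs_def])
  moreover have "f' (axis ?j h) = state_cost_deriv c i \<theta> a * h" for h
  proof -
    have "f' (axis ?j h) = h * f' (axis ?j 1)"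
      using has_derivative_linear[OF f'] by (subst ax) (simp add: linear_cmul)
    then show ?thesis by (simp add: state_cost_deriv_def grad_cost_def f'_def)
  qed
  ultimately show ?thesis by (simp add: has_field_derivative_def)
qed

lemma state_cost_convex_family:
  "\<exists>K\<ge>0. \<exists>\<gamma>. \<forall>i. convex_family prob_simplex (state_cost c i) (state_cost_deriv c i) K \<gamma>"
proof -
  obtain K1 where K1: "\<And>i \<alpha>. \<alpha> \<in> quadrant \<Longrightarrow> K1-lipschitz_on prob_simplex (\<lambda>\<theta>. c i \<theta> \<alpha>)"
    using lipschitz_cost by blast
  obtain K2 where K2: "\<And>i \<alpha>. \<alpha> \<in> quadrant \<Longrightarrow> K2-lipschitz_on prob_simplex (\<lambda>\<theta>. grad_cost c i \<theta> \<alpha>)"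
    using lipschitz_grad by blast
  obtain \<gamma> where \<gamma>: "\<gamma> > 0" "\<And>i j \<theta> \<alpha> \<alpha>'. \<lbrakk>j \<noteq> i; \<theta> \<in> prob_simplex; \<alpha> \<in> quadrant; \<alpha>' \<in> quadrant; \<alpha>$j \<noteq> \<alpha>'$j\<rbrakk>
      \<Longrightarrow> c i \<theta> \<alpha>' - c i \<theta> \<alpha> \<ge> grad_cost c i \<theta> \<alpha> \<bullet> (\<alpha>' - \<alpha>) + \<gamma> * \<bar>\<alpha>'$j - \<alpha>$j\<bar>^2"
    using uniformly_convex by blast
  have "convex_family prob_simplex (state_cost c i) (state_cost_deriv c i) (max K1 K2) \<gamma>" for i
  proof
    fix \<theta> and a :: real
    assume \<theta>: "\<theta> \<in> prob_simplex" and a: "0 \<le> a"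
    show "(state_cost c i \<theta> has_real_derivative state_cost_deriv c i \<theta> a) (at a within {0..})"
      by (rule state_cost_has_derivative[OF \<theta> a])
    fix b :: real
    assume b: "0 \<le> b"
    have diff: "axis (other i) b - axis (other i) a = axis (other i) (b - a)"
      by (simp add: vec_eq_iff axis_def)
    show "state_cost c i \<theta> b \<ge> state_cost c i \<theta> a + state_cost_deriv c i \<theta> a * (b - a) + \<gamma> * (b - a)\<^sup>2"
    \<comment> \<open>Uniform convexity is assumed only for distinct coordinates; for equal ones the
      inequality is trivial.\<close>
    proof (cases "a = b")
      case False
      then show ?thesis
        using \<gamma>(2)[OF other_neq[of i] \<theta> axis_in_quadrant[OF a, of "other i"] axis_in_quadrant[OF b, of "other i"]]
        by (simp add: state_cost_def state_cost_deriv_def diff inner_axis algebra_simps)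
    qed simp
  next
    fix \<theta> \<theta>' and a :: real
    assume \<theta>: "\<theta> \<in> prob_simplex" "\<theta>' \<in> prob_simplex" and a: "0 \<le> a"
    have K: "K1 * dist \<theta> \<theta>' \<le> max K1 K2 * dist \<theta> \<theta>'" "K2 * dist \<theta> \<theta>' \<le> max K1 K2 * dist \<theta> \<theta>'"
      by (intro mult_right_mono; simp)+
    show "\<bar>state_cost c i \<theta> a - state_cost c i \<theta>' a\<bar> \<le> max K1 K2 * dist \<theta> \<theta>'"
      using lipschitz_onD[OF K1[OF axis_in_quadrant[OF a]] \<theta>] K(1)
      by (simp add: state_cost_def dist_real_def) (metis order_trans)
    have "\<bar>state_cost_deriv c i \<theta> a - state_cost_deriv c i \<theta>' a\<bar>
        \<le> dist (grad_cost c i \<theta> (axis (other i) a)) (grad_cost c i \<theta>' (axis (other i) a))"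
      unfolding state_cost_deriv_def dist_norm by (metis component_le_norm_cart vector_minus_component)
    also have "\<dots> \<le> K2 * dist \<theta> \<theta>'"
      by (rule lipschitz_onD[OF K2[OF axis_in_quadrant[OF a]] \<theta>])
    finally show "\<bar>state_cost_deriv c i \<theta> a - state_cost_deriv c i \<theta>' a\<bar> \<le> max K1 K2 * dist \<theta> \<theta>'"
      using K(2) by linarith
  qed (fact \<gamma>)
  moreover have "0 \<le> max K1 K2"
    using lipschitz_on_nonneg[OF K1[OF axis_in_quadrant[OF order_refl]]] by simp
  ultimately show ?thesis by blast
qed

text \<open>The own coordinate enters neither the cost nor the linear term, because
  \<open>Delta i z\<close> vanishes there.\<close>

lemma legendre_obj_eq:
  assumes "\<theta> \<in> prob_simplex" "\<mu> \<in> quadrant"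
  shows "legendre_obj c z \<theta> i \<mu> =
    state_cost c i \<theta> (\<mu> $ other i) + (z $ other i - z $ i) * \<mu> $ other i"
proof -
  have "c i \<theta> \<mu> = c i \<theta> (axis (other i) (\<mu> $ other i))"
    using assms by (intro independent_own_coordinate)
      (auto simp: eq_other_iff quadrant_def axis_def)
  moreover have "\<mu> \<bullet> Delta i z = (z $ other i - z $ i) * \<mu> $ other i"
    using exhaust_2[of i] by (auto simp: inner_vec_def sum_2 Delta_def other_def)
  ultimately show ?thesis by (simp add: legendre_obj_def state_cost_def)
qed

text \<open>Existence and uniqueness for the one-variable problem give meaning to the
  \<open>THE\<close> in \<open>opt_rate\<close> and the \<open>LEAST\<close> in
  \<open>legendre_h\<close>.\<close>

lemma opt_rate_legendre_h:
  assumes "convex_family prob_simplex (state_cost c i) (state_cost_deriv c i) K \<gamma>"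
    and \<theta>: "\<theta> \<in> prob_simplex"
  shows "convex_family.minimiser (state_cost c i) (z $ other i - z $ i) \<theta> (opt_rate c z \<theta> i)"
    and "legendre_h c z \<theta> i =
      state_cost c i \<theta> (opt_rate c z \<theta> i) + (z $ other i - z $ i) * opt_rate c z \<theta> i"
proof -
  interpret convex_family prob_simplex "state_cost c i" "state_cost_deriv c i" K \<gamma> by fact
  let ?p = "z $ other i - z $ i"
  obtain a where a: "minimiser ?p \<theta> a" using minimiser_exists[OF \<theta>] by blast
  \<comment> \<open>Uniqueness is the Lipschitz estimate with equal data, whose right-hand side is
    0.\<close>
  have uniq: "b = a" if "minimiser ?p \<theta> b" for b
    using minimiser_lipschitz[OF \<theta> \<theta> that a] by simp
  have q: "axis (other i) b \<in> quadrant" if "b \<ge> 0" for b using that by (rule axis_in_quadrant)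
  \<comment> \<open>The own coordinate of \<mu> is free within the quadrant: the minimising vector
    is not unique, only its other coordinate is.\<close>
  have argmin: "is_arg_min (legendre_obj c z \<theta> i) (\<lambda>\<mu>. \<mu> \<in> quadrant) \<mu> \<longleftrightarrow>
      \<mu> \<in> quadrant \<and> minimiser ?p \<theta> (\<mu> $ other i)" for \<mu>
  proof
    assume l: "is_arg_min (legendre_obj c z \<theta> i) (\<lambda>\<mu>. \<mu> \<in> quadrant) \<mu>"
    then have \<mu>: "\<mu> \<in> quadrant" by (simp add: is_arg_min_def)
    have "legendre_obj c z \<theta> i \<mu> \<le> legendre_obj c z \<theta> i (axis (other i) b)" if "b \<ge> 0" for b
      using l q[OF that] by (force simp: is_arg_min_def)
    then show "\<mu> \<in> quadrant \<and> minimiser ?p \<theta> (\<mu> $ other i)"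
      using \<mu> q by (auto simp: minimiser_def legendre_obj_eq[OF \<theta>] quadrant_def)
  next
    assume "\<mu> \<in> quadrant \<and> minimiser ?p \<theta> (\<mu> $ other i)"
    then show "is_arg_min (legendre_obj c z \<theta> i) (\<lambda>\<mu>. \<mu> \<in> quadrant) \<mu>"
      by (auto simp: is_arg_min_def not_less minimiser_def legendre_obj_eq[OF \<theta>])
        (auto simp: quadrant_def)
  qed
  have a0: "a \<ge> 0" using a by (simp add: minimiser_def)
  have rate: "opt_rate c z \<theta> i = a"
    unfolding opt_rate_def
  proof (rule the_equality)
    show "\<exists>\<mu>. is_arg_min (legendre_obj c z \<theta> i) (\<lambda>\<mu>. \<mu> \<in> quadrant) \<mu> \<and> a = \<mu> $ other i"
      using a q[OF a0] by (intro exI[of _ "axis (other i) a"]) (simp add: argmin)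
  qed (use uniq argmin in blast)
  show "minimiser ?p \<theta> (opt_rate c z \<theta> i)" using a rate by simp
  have "legendre_h c z \<theta> i = state_cost c i \<theta> a + ?p * a"
    unfolding legendre_h_def
  proof (rule Least_equality)
    show "state_cost c i \<theta> a + ?p * a \<in> legendre_obj c z \<theta> i ` quadrant"
      using q[OF a0] legendre_obj_eq[OF \<theta> q[OF a0]] by (intro image_eqI[of _ _ "axis (other i) a"]) simp_all
    fix y
    assume "y \<in> legendre_obj c z \<theta> i ` quadrant"
    then show "state_cost c i \<theta> a + ?p * a \<le> y"
      using a by (auto simp: legendre_obj_eq[OF \<theta>] minimiser_def quadrant_def)
  qed
  then show "legendre_h c z \<theta> i = state_cost c i \<theta> (opt_rate c z \<theta> i) + ?p * opt_rate c z \<theta> i"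
    by (simp add: rate)
qed

end

section \<open>The two-state mean field game\<close>

lemma vector_in_prob_simplex: "x \<in> {0..1} \<Longrightarrow> vector [x, 1 - x] \<in> prob_simplex"
  by (simp add: prob_simplex_def forall_2 vector_2)

lemma dist_simplex_le: "dist (vector [x, 1 - x] :: real^2) (vector [y, 1 - y]) \<le> 2 * \<bar>x - y\<bar>"
proof -
  have "dist (vector [x, 1 - x] :: real^2) (vector [y, 1 - y])
      \<le> (\<Sum>i\<in>UNIV. \<bar>(vector [x, 1 - x] - vector [y, 1 - y] :: real^2) $ i\<bar>)"
    unfolding dist_norm by (rule norm_le_l1_cart)
  also have "\<dots> = 2 * \<bar>x - y\<bar>" by (simp add: sum_2 vector_2)
  finally show ?thesis .
qed

text \<open>For the potential \<open>(u, 0)\<close> the difference is \<open>- u\<close> in state 1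
  and \<open>u\<close> in state 2, so the state disappears under the absolute value.\<close>

lemma abs_potential_diff:
  "\<bar>((vector [u, 0] :: real^2) $ other i - (vector [u, 0] :: real^2) $ i)
    - ((vector [v, 0] :: real^2) $ other i - (vector [v, 0] :: real^2) $ i)\<bar> = \<bar>u - v\<bar>"
  using exhaust_2[of i] by (auto simp: other_def vector_2)

context running_cost
begin

lemma opt_rate_nonneg:
  assumes "x \<in> {0..1}"
  shows "opt_rate c z (vector [x, 1 - x]) i \<ge> 0"
proof -
  obtain K \<gamma> where cf: "convex_family prob_simplex (state_cost c i) (state_cost_deriv c i) K \<gamma>"
    using state_cost_convex_family by blast
  show ?thesis
    using opt_rate_legendre_h(1)[OF cf vector_in_prob_simplex[OF assms]]
    by (simp add: convex_family.minimiser_def[OF cf])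
qed

text \<open>The rates are globally Lipschitz, whereas the estimate for \<open>legendre_h\<close>
  carries the rate itself as a factor and so becomes a Lipschitz bound only for bounded
  potentials.\<close>

lemma opt_rate_legendre_h_lipschitz:
  obtains A D where "A \<ge> 0" "D \<ge> 0"
    "\<And>i u v x y. \<lbrakk>x \<in> {0..1}; y \<in> {0..1}\<rbrakk> \<Longrightarrow>
      \<bar>opt_rate c (vector [u, 0]) (vector [x, 1 - x]) i - opt_rate c (vector [v, 0]) (vector [y, 1 - y]) i\<bar>
        \<le> A * (\<bar>u - v\<bar> + \<bar>x - y\<bar>)"
    "\<And>i u v x y. \<lbrakk>x \<in> {0..1}; y \<in> {0..1}\<rbrakk> \<Longrightarrow>
      legendre_h c (vector [u, 0]) (vector [x, 1 - x]) i - legendre_h c (vector [v, 0]) (vector [y, 1 - y]) i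
        \<le> D * \<bar>x - y\<bar> + \<bar>u - v\<bar> * opt_rate c (vector [v, 0]) (vector [y, 1 - y]) i"
proof -
  obtain K \<gamma> where K: "K \<ge> 0"
    and cf: "\<And>i. convex_family prob_simplex (state_cost c i) (state_cost_deriv c i) K \<gamma>"
    using state_cost_convex_family by blast
  have \<gamma>: "\<gamma> > 0" using convex_family.\<gamma>_pos[OF cf] .
  have dist: "K * dist (vector [x, 1 - x] :: real^2) (vector [y, 1 - y]) \<le> 2 * K * \<bar>x - y\<bar>" for x y
    using mult_left_mono[OF dist_simplex_le K, of x y] by (simp add: mult.assoc mult.left_commute)
  show thesis
  proof
    \<comment> \<open>The factor 2 before \<open>K\<close> is the distortion of
      \<open>dist_simplex_le\<close>; the 1 accounts for the potential.\<close>
    show "(2 * K + 1) / (2 * \<gamma>) \<ge> 0" "2 * K \<ge> 0" using K \<gamma> by auto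
    fix i :: 2 and u v x y :: real
    assume xy: "x \<in> {0..1}" "y \<in> {0..1}"
    note s = vector_in_prob_simplex[OF xy(1)] vector_in_prob_simplex[OF xy(2)]
    note m = opt_rate_legendre_h[OF cf[of i] s(1), of "vector [u, 0]"] opt_rate_legendre_h[OF cf[of i] s(2), of "vector [v, 0]"]
    have "\<bar>opt_rate c (vector [u, 0]) (vector [x, 1 - x]) i - opt_rate c (vector [v, 0]) (vector [y, 1 - y]) i\<bar>
        \<le> (K * dist (vector [x, 1 - x] :: real^2) (vector [y, 1 - y]) + \<bar>u - v\<bar>) / (2 * \<gamma>)"
      using convex_family.minimiser_lipschitz[OF cf s m(1,3)] unfolding abs_potential_diff .
    also have "\<dots> \<le> (2 * K + 1) * (\<bar>u - v\<bar> + \<bar>x - y\<bar>) / (2 * \<gamma>)"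
    proof (rule divide_right_mono)
      have "0 \<le> K * \<bar>u - v\<bar>" using K by simp
      then show "K * dist (vector [x, 1 - x] :: real^2) (vector [y, 1 - y]) + \<bar>u - v\<bar>
          \<le> (2 * K + 1) * (\<bar>u - v\<bar> + \<bar>x - y\<bar>)"
        using dist[of x y] by (simp add: distrib_left distrib_right)
    qed (use \<gamma> in simp)
    finally show "\<bar>opt_rate c (vector [u, 0]) (vector [x, 1 - x]) i - opt_rate c (vector [v, 0]) (vector [y, 1 - y]) i\<bar>
        \<le> (2 * K + 1) / (2 * \<gamma>) * (\<bar>u - v\<bar> + \<bar>x - y\<bar>)" by simp
    show "legendre_h c (vector [u, 0]) (vector [x, 1 - x]) i - legendre_h c (vector [v, 0]) (vector [y, 1 - y]) i
        \<le> 2 * K * \<bar>x - y\<bar> + \<bar>u - v\<bar> * opt_rate c (vector [v, 0]) (vector [y, 1 - y]) i"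
      using convex_family.minimum_diff_le[OF cf s m(1,3)] dist[of x y]
      unfolding abs_potential_diff m(2,4) by linarith
  qed
qed

lemma mfg_r_eq:
  "mfg_r c u x = x * opt_rate c (vector [u, 0]) (vector [x, 1 - x]) 1
     - (1 - x) * opt_rate c (vector [u, 0]) (vector [x, 1 - x]) 2"
  by (simp add: mfg_r_def mfg_g1_def alpha_star_def vector_2)

text \<open>At each endpoint all mass sits in one state, and only the nonnegative rate out of that
  state survives, with the sign from \<open>mfg_r_eq\<close>.\<close>

lemma mfg_r_boundary: "mfg_r c u 0 \<le> 0" "mfg_r c u 1 \<ge> 0"
  using opt_rate_nonneg[of 0] opt_rate_nonneg[of 1] by (simp_all add: mfg_r_eq)

text \<open>On a bounded range of potentials the rates are bounded, so products of rates and masses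
  are Lipschitz and so is \<open>legendre_h\<close>.\<close>

lemma mfg_lipschitz:
  assumes "R \<ge> 0"
  obtains A where "A \<ge> 0"
    "\<And>u v x y. \<lbrakk>\<bar>u\<bar> \<le> R; \<bar>v\<bar> \<le> R; x \<in> {0..1}; y \<in> {0..1}\<rbrakk> \<Longrightarrow>
      \<bar>mfg_r c u x - mfg_r c v y\<bar> \<le> A * (\<bar>u - v\<bar> + \<bar>x - y\<bar>) \<and>
      \<bar>mfg_q c u x - mfg_q c v y\<bar> \<le> A * (\<bar>u - v\<bar> + \<bar>x - y\<bar>)"
proof -
  define \<alpha> where "\<alpha> u x i = opt_rate c (vector [u, 0]) (vector [x, 1 - x]) i" for u x :: real and i
  define h where "h u x i = legendre_h c (vector [u, 0]) (vector [x, 1 - x]) i" for u x :: real and i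
  obtain A D where AD: "A \<ge> 0" "D \<ge> 0"
    and A: "\<And>i u v x y. \<lbrakk>x \<in> {0..1}; y \<in> {0..1}\<rbrakk> \<Longrightarrow> \<bar>\<alpha> u x i - \<alpha> v y i\<bar> \<le> A * (\<bar>u - v\<bar> + \<bar>x - y\<bar>)"
    and D: "\<And>i u v x y. \<lbrakk>x \<in> {0..1}; y \<in> {0..1}\<rbrakk> \<Longrightarrow> h u x i - h v y i \<le> D * \<bar>x - y\<bar> + \<bar>u - v\<bar> * \<alpha> v y i"
    using opt_rate_legendre_h_lipschitz unfolding \<alpha>_def h_def by metis
  \<comment> \<open>This bounds the rates of both states: their values at the origin plus the
    Lipschitz growth, since \<open>\<bar>u\<bar> + \<bar>x\<bar> \<le> R + 1\<close>.\<close>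
  define B where "B = \<alpha> 0 0 1 + \<alpha> 0 0 2 + A * (R + 1)"
  have \<alpha>0: "\<alpha> u x i \<ge> 0" if "x \<in> {0..1}" for u x i
    unfolding \<alpha>_def by (rule opt_rate_nonneg[OF that])
  have B0: "B \<ge> 0" using \<alpha>0[of 0] AD assms by (simp add: B_def)
  have \<alpha>B: "\<alpha> u x i \<le> B" if "\<bar>u\<bar> \<le> R" "x \<in> {0..1}" for u x i
  proof -
    have "\<alpha> u x i \<le> \<alpha> 0 0 i + A * (\<bar>u\<bar> + \<bar>x\<bar>)" using A[of x 0 u i 0] that by simp
    also have "\<dots> \<le> \<alpha> 0 0 i + A * (R + 1)" using that AD by (intro add_mono mult_left_mono) auto
    also have "\<dots> \<le> B" using \<alpha>0[of 0] exhaust_2[of i] by (auto simp: B_def)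
    finally show ?thesis .
  qed
  show thesis
  proof (rule that[of "2 * (A + B + D)"])
    fix u v x y :: real
    assume u: "\<bar>u\<bar> \<le> R" and v: "\<bar>v\<bar> \<le> R" and x: "x \<in> {0..1}" and y: "y \<in> {0..1}"
    let ?d = "\<bar>u - v\<bar> + \<bar>x - y\<bar>"
    have prod: "\<bar>s * \<alpha> u x i - s' * \<alpha> v y i\<bar> \<le> A * ?d + B * \<bar>x - y\<bar>"
      if s: "\<bar>s\<bar> \<le> 1" "\<bar>s - s'\<bar> = \<bar>x - y\<bar>" for s s' i
    proof -
      have "\<bar>s * \<alpha> u x i - s' * \<alpha> v y i\<bar> = \<bar>s * (\<alpha> u x i - \<alpha> v y i) + (s - s') * \<alpha> v y i\<bar>"
        by (simp add: algebra_simps)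
      also have "\<dots> \<le> \<bar>s\<bar> * \<bar>\<alpha> u x i - \<alpha> v y i\<bar> + \<bar>x - y\<bar> * \<alpha> v y i"
        using \<alpha>0[OF y] by (metis abs_mult abs_of_nonneg abs_triangle_ineq s(2))
      also have "\<dots> \<le> 1 * (A * ?d) + \<bar>x - y\<bar> * B"
        using s A[OF x y] \<alpha>0[OF y] \<alpha>B[OF v y] by (intro add_mono mult_mono) auto
      finally show ?thesis by (simp add: mult.commute)
    qed
    have "\<bar>mfg_r c u x - mfg_r c v y\<bar>
        \<le> \<bar>x * \<alpha> u x 1 - y * \<alpha> v y 1\<bar> + \<bar>(1 - x) * \<alpha> u x 2 - (1 - y) * \<alpha> v y 2\<bar>"
      unfolding mfg_r_eq \<alpha>_def by linarith
    also have "\<dots> \<le> 2 * (A * ?d + B * \<bar>x - y\<bar>)"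
      using prod[of x y 1] prod[of "1 - x" "1 - y" 2] abs_minus_commute[of y x] x y by auto
    also have "\<dots> \<le> 2 * (A + B + D) * ?d"
      using AD B0 by (simp add: algebra_simps)
    finally have r: "\<bar>mfg_r c u x - mfg_r c v y\<bar> \<le> 2 * (A + B + D) * ?d" .
    have hh: "\<bar>h u x i - h v y i\<bar> \<le> (B + D) * ?d" for i
    proof -
      have "h u x i - h v y i \<le> D * \<bar>x - y\<bar> + \<bar>u - v\<bar> * B"
        using D[OF x y, of u i v] mult_left_mono[OF \<alpha>B[OF v y, of i], of "\<bar>u - v\<bar>"] by linarith
      moreover have "h v y i - h u x i \<le> D * \<bar>x - y\<bar> + \<bar>u - v\<bar> * B"
        using D[OF y x, of v i u] mult_left_mono[OF \<alpha>B[OF u x, of i], of "\<bar>u - v\<bar>"]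
        by (simp add: abs_minus_commute)
      moreover have "D * \<bar>x - y\<bar> + \<bar>u - v\<bar> * B \<le> (B + D) * ?d"
        using AD B0 by (simp add: algebra_simps)
      ultimately show ?thesis by linarith
    qed
    have "\<bar>mfg_q c u x - mfg_q c v y\<bar> \<le> \<bar>h u x 1 - h v y 1\<bar> + \<bar>h u x 2 - h v y 2\<bar>"
      unfolding mfg_q_def h_def by linarith
    also have "\<dots> \<le> 2 * ((B + D) * ?d)" using hh[of 1] hh[of 2] by linarith
    also have "\<dots> \<le> 2 * (A + B + D) * ?d" using AD by (simp add: algebra_simps)
    finally show "\<bar>mfg_r c u x - mfg_r c v y\<bar> \<le> 2 * (A + B + D) * ?d \<and>
        \<bar>mfg_q c u x - mfg_q c v y\<bar> \<le> 2 * (A + B + D) * ?d" using r by blast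
  qed (use AD B0 in simp)
qed

end

section \<open>Continuously differentiable functions on the space-time rectangle\<close>

lemma C1_rect_derivs:
  assumes "C1_rect T w" "x \<in> {0..1}" "t \<in> {0..T}"
  shows "((\<lambda>x. w x t) has_real_derivative d_zeta w x t) (at x within {0..1})"
    and "((\<lambda>s. w x s) has_real_derivative d_time T w x t) (at t within {0..T})"
  using assms unfolding C1_rect_def d_zeta_def d_time_def has_real_derivative_iff_has_vector_derivative
  by (simp_all add: vector_derivative_works[symmetric])

text \<open>Continuous partial derivatives are bounded on the compact rectangle; the mean value
  inequality does the rest.\<close>

lemma C1_rect_lipschitz:
  assumes w: "C1_rect T w"
  obtains B where "B \<ge> 0"
    "\<And>x y t. \<lbrakk>x \<in> {0..1}; y \<in> {0..1}; t \<in> {0..T}\<rbrakk> \<Longrightarrow> \<bar>w x t - w y t\<bar> \<le> B * \<bar>x - y\<bar>"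
    "\<And>x s t. \<lbrakk>x \<in> {0..1}; s \<in> {0..T}; t \<in> {0..T}\<rbrakk> \<Longrightarrow> \<bar>w x s - w x t\<bar> \<le> B * \<bar>s - t\<bar>"
proof -
  have comp: "compact ({0..1::real} \<times> {0..T})" by (intro compact_Times compact_Icc)
  have "continuous_on ({0..1} \<times> {0..T}) (\<lambda>(x, t). d_zeta w x t)"
    "continuous_on ({0..1} \<times> {0..T}) (\<lambda>(x, t). d_time T w x t)"
    using w by (auto simp: C1_rect_def)
  then have "bounded ((\<lambda>(x, t). d_zeta w x t) ` ({0..1} \<times> {0..T}))"
    "bounded ((\<lambda>(x, t). d_time T w x t) ` ({0..1} \<times> {0..T}))"
    using comp by (auto intro: compact_imp_bounded compact_continuous_image)
  then obtain B1 B2 where B: "B1 > 0" "B2 > 0"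
    "\<And>x t. x \<in> {0..1} \<Longrightarrow> t \<in> {0..T} \<Longrightarrow> norm (d_zeta w x t) \<le> B1"
    "\<And>x t. x \<in> {0..1} \<Longrightarrow> t \<in> {0..T} \<Longrightarrow> norm (d_time T w x t) \<le> B2"
    unfolding bounded_pos by fastforce
  show thesis
  proof (rule that[of "max B1 B2"])
    fix x y t :: real assume xy: "x \<in> {0..1}" "y \<in> {0..1}" "t \<in> {0..T}"
    have "norm (w x t - w y t) \<le> B1 * norm (x - y)"
      by (rule field_differentiable_bound[OF _ C1_rect_derivs(1)[OF w]]) (use xy B in auto)
    also have "\<dots> \<le> max B1 B2 * norm (x - y)" by (intro mult_right_mono) auto
    finally show "\<bar>w x t - w y t\<bar> \<le> max B1 B2 * \<bar>x - y\<bar>" by simp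
  next
    fix x s t :: real assume xy: "x \<in> {0..1}" "s \<in> {0..T}" "t \<in> {0..T}"
    have "norm (w x s - w x t) \<le> B2 * norm (s - t)"
      by (rule field_differentiable_bound[OF _ C1_rect_derivs(2)[OF w]]) (use xy B in auto)
    also have "\<dots> \<le> max B1 B2 * norm (s - t)" by (intro mult_right_mono) auto
    finally show "\<bar>w x s - w x t\<bar> \<le> max B1 B2 * \<bar>s - t\<bar>" by simp
  qed (use B in auto)
qed

text \<open>\<open>C1_rect\<close> asks for joint continuity of the partial derivatives only; for
  \<open>w\<close> itself it follows from the Lipschitz bounds in each variable, moving first in
  space and then in time.\<close>

lemma C1_rect_continuous:
  assumes w: "C1_rect T w"
  shows "continuous_on ({0..1} \<times> {0..T}) (\<lambda>(x, t). w x t)"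
proof -
  obtain B where B: "B \<ge> 0"
    "\<And>x y t. \<lbrakk>x \<in> {0..1}; y \<in> {0..1}; t \<in> {0..T}\<rbrakk> \<Longrightarrow> \<bar>w x t - w y t\<bar> \<le> B * \<bar>x - y\<bar>"
    "\<And>x s t. \<lbrakk>x \<in> {0..1}; s \<in> {0..T}; t \<in> {0..T}\<rbrakk> \<Longrightarrow> \<bar>w x s - w x t\<bar> \<le> B * \<bar>s - t\<bar>"
    using C1_rect_lipschitz[OF w] by blast
  have "(2 * B)-lipschitz_on ({0..1} \<times> {0..T}) (\<lambda>(x, t). w x t)"
  proof (rule lipschitz_onI)
    fix p p' :: "real \<times> real"
    assume "p \<in> {0..1} \<times> {0..T}" "p' \<in> {0..1} \<times> {0..T}"
    then have p: "fst p \<in> {0..1}" "snd p \<in> {0..T}" "fst p' \<in> {0..1}" "snd p' \<in> {0..T}" by auto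
    have "\<bar>fst p - fst p'\<bar> \<le> dist p p'" "\<bar>snd p - snd p'\<bar> \<le> dist p p'"
      using dist_fst_le[of p p'] dist_snd_le[of p p'] by (auto simp: dist_real_def)
    then have "B * \<bar>fst p - fst p'\<bar> \<le> B * dist p p'" "B * \<bar>snd p - snd p'\<bar> \<le> B * dist p p'"
      using B(1) by (auto intro: mult_left_mono)
    then show "dist (case p of (x, t) \<Rightarrow> w x t) (case p' of (x, t) \<Rightarrow> w x t) \<le> 2 * B * dist p p'"
      using B(2)[OF p(1,3,2)] B(3)[OF p(3,2,4)] by (simp add: case_prod_unfold dist_real_def)
  qed (use B in auto)
  then show ?thesis by (rule lipschitz_on_continuous_on)
qed

section \<open>Essential supremum and least Lipschitz constant\<close>

lemma Linf_norm_le: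
  assumes "continuous_on {0..1} f" "\<And>x. x \<in> {0..1} \<Longrightarrow> \<bar>f x\<bar> \<le> B"
  shows "Linf_norm f \<le> ereal B"
  unfolding Linf_norm_def
proof (rule esssup_I)
  have "f \<in> borel_measurable (lebesgue_on {0..1})"
    by (rule continuous_imp_measurable_on_sets_lebesgue[OF assms(1)]) simp
  then show "(\<lambda>x. ereal \<bar>f x\<bar>) \<in> borel_measurable (lebesgue_on {0..1})" by measurable
  show "AE x in lebesgue_on {0..1}. ereal \<bar>f x\<bar> \<le> ereal B"
    by (rule AE_I2) (use assms(2) in simp)
qed

text \<open>By continuity a bound valid almost everywhere holds on a closed set; having full measure
  in (0,1), that set contains (0,1) and its closure.\<close>

lemma le_Linf_norm:
  assumes f: "continuous_on {0..1} f" and x: "x \<in> {0..1}"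
  shows "ereal \<bar>f x\<bar> \<le> Linf_norm f"
proof (rule ereal_le_real)
  fix e assume e: "Linf_norm f \<le> ereal e"
  \<comment> \<open>Clamping extends \<open>f\<close> continuously to the line, so that
    \<open>C\<close> is closed there.\<close>
  define g where "g y = f (max 0 (min 1 y))" for y
  have g: "continuous_on UNIV g"
    unfolding g_def by (rule continuous_on_compose2[OF f]) (auto intro!: continuous_intros)
  define C where "C = {y. \<bar>g y\<bar> \<le> e}"
  have C: "closed C"
    unfolding C_def by (intro closed_Collect_le continuous_intros g)
  have "AE y in lebesgue_on {0..1}. ereal \<bar>f y\<bar> \<le> Linf_norm f"
    unfolding Linf_norm_def by (rule esssup_AE)
  then have "AE y in lebesgue. y \<in> {0..1} \<longrightarrow> ereal \<bar>f y\<bar> \<le> Linf_norm f"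
    by (simp add: AE_restrict_space_iff)
  then have "AE y \<in> {0<..<1} in lebesgue. y \<in> C"
    by eventually_elim (use e in \<open>auto simp: C_def g_def dest: order_trans\<close>)
  then have "{0<..<1} \<subseteq> C"
    using mem_closed_if_AE_lebesgue_open[OF open_greaterThanLessThan C] by blast
  then have "closure {0<..<1} \<subseteq> C" using C by (rule closure_minimal)
  then show "ereal \<bar>f x\<bar> \<le> ereal e" using x by (auto simp: C_def g_def)
qed

text \<open>The infimum is itself a Lipschitz constant, because every difference quotient is a lower
  bound of the set.\<close>

lemma lipschitz_const_bound:
  assumes "B-lipschitz_on {0..1} f"
  shows "0 \<le> lipschitz_const f"
    and "x \<in> {0..1} \<Longrightarrow> y \<in> {0..1} \<Longrightarrow> \<bar>f x - f y\<bar> \<le> lipschitz_const f * \<bar>x - y\<bar>"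
proof -
  have ne: "{L. L-lipschitz_on {0..1} f} \<noteq> {}" using assms by blast
  show "0 \<le> lipschitz_const f"
    unfolding lipschitz_const_def using lipschitz_on_nonneg by (intro cInf_greatest[OF ne]) auto
  assume xy: "x \<in> {0..1}" "y \<in> {0..1}"
  show "\<bar>f x - f y\<bar> \<le> lipschitz_const f * \<bar>x - y\<bar>"
  proof (cases "x = y")
    case False
    have "\<bar>f x - f y\<bar> / \<bar>x - y\<bar> \<le> lipschitz_const f"
      unfolding lipschitz_const_def
    proof (rule cInf_greatest[OF ne])
      fix L assume "L \<in> {L. L-lipschitz_on {0..1} f}"
      then show "\<bar>f x - f y\<bar> / \<bar>x - y\<bar> \<le> L"
        using lipschitz_onD[of L "{0..1}" f x y] xy False by (simp add: dist_real_def divide_le_eq)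
    qed
    then show ?thesis using False by (simp add: divide_le_eq)
  qed simp
qed

text \<open>The length \<open>\<delta>\<close> is fixed before \<open>w\<close>, from bounds on
  \<open>r\<close> and \<open>q\<close> over the range \<open>M + 2\<close> that the sup bound
  guarantees in advance.\<close>

lemma (in running_cost) short_time_gradient_bound:
  assumes "T > 0" "M \<ge> 0" "L \<ge> 0"
  shows "\<exists>\<delta>. 0 < \<delta> \<and> \<delta> \<le> T \<and> (\<forall>w. smooth_solution c T w \<longrightarrow> (\<forall>x\<in>{0..1}. \<bar>w x T\<bar> \<le> M) \<longrightarrow>
    (\<forall>x\<in>{0..1}. \<forall>y\<in>{0..1}. \<bar>w x T - w y T\<bar> \<le> L * \<bar>x - y\<bar>) \<longrightarrow>
    (\<forall>t\<in>{T - \<delta>..T}. \<forall>x\<in>{0..1}. \<bar>d_zeta w x t\<bar> \<le> L + 2))"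
proof -
  obtain A where A: "A \<ge> 0"
    and lip: "\<And>u v x y. \<lbrakk>\<bar>u\<bar> \<le> M + 2; \<bar>v\<bar> \<le> M + 2; x \<in> {0..1}; y \<in> {0..1}\<rbrakk> \<Longrightarrow>
      \<bar>mfg_r c u x - mfg_r c v y\<bar> \<le> A * (\<bar>u - v\<bar> + \<bar>x - y\<bar>) \<and>
      \<bar>mfg_q c u x - mfg_q c v y\<bar> \<le> A * (\<bar>u - v\<bar> + \<bar>x - y\<bar>)"
  proof (rule mfg_lipschitz)
    show "0 \<le> M + 2" using assms by simp
  qed (rule that)
  define Q where "Q = \<bar>mfg_q c 0 0\<bar> + A * (M + 3)"
  define P where "P = A * (L + 3)\<^sup>2 + 1"
  \<comment> \<open>The three terms keep the interval inside [0,T] and let the value barrier and the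
    slope barrier each grow by at most 1.\<close>
  define \<delta> where "\<delta> = min T (min (1 / (Q + 1)) (1 / P))"
  have Q0: "Q \<ge> 0" using A assms by (simp add: Q_def)
  have P0: "P > 0" using A by (simp add: P_def add_nonneg_pos)
  have Q: "\<bar>mfg_q c u x\<bar> \<le> Q" if "\<bar>u\<bar> \<le> M + 2" "x \<in> {0..1}" for u x
  proof -
    have "\<bar>mfg_q c u x - mfg_q c 0 0\<bar> \<le> A * (\<bar>u\<bar> + \<bar>x\<bar>)"
      using lip[of u 0 x 0] that assms by simp
    also have "\<dots> \<le> A * (M + 3)" using that A by (intro mult_left_mono) auto
    finally show ?thesis by (simp add: Q_def)
  qed
  have \<delta>: "0 < \<delta>" "\<delta> \<le> T" using Q0 P0 assms by (auto simp: \<delta>_def)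
  have "\<delta> \<le> 1 / (Q + 1)" "\<delta> \<le> 1 / P" by (auto simp: \<delta>_def)
  then have small: "(Q + 1) * (T - (T - \<delta>)) \<le> 1" "P * (T - (T - \<delta>)) \<le> 1"
    using Q0 P0 by (simp_all add: field_simps)
  have "\<bar>d_zeta w x t\<bar> \<le> L + 2"
    if w: "smooth_solution c T w" and M: "\<forall>x\<in>{0..1}. \<bar>w x T\<bar> \<le> M"
      and L: "\<forall>x\<in>{0..1}. \<forall>y\<in>{0..1}. \<bar>w x T - w y T\<bar> \<le> L * \<bar>x - y\<bar>"
      and t: "t \<in> {T - \<delta>..T}" and x: "x \<in> {0..1}" for w x t
  proof -
    have C1: "C1_rect T w" using w by (simp add: smooth_solution_def)
    have sub: "{T - \<delta>..T} \<subseteq> {0..T}" using \<delta> by auto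
    interpret transport_equation "T - \<delta>" T "mfg_r c" "mfg_q c" w "d_zeta w" "d_time T w"
    proof
      show "continuous_on ({0..1} \<times> {T - \<delta>..T}) (\<lambda>(x, t). w x t)"
        using C1_rect_continuous[OF C1] by (rule continuous_on_subset) (use sub in auto)
      show "mfg_r c u 0 \<le> 0" "0 \<le> mfg_r c u 1" for u by (rule mfg_r_boundary)+
      fix x t :: real
      assume x: "x \<in> {0..1}" and "t \<in> {T - \<delta>..T}"
      then have t: "t \<in> {0..T}" using sub by blast
      show "((\<lambda>x. w x t) has_real_derivative d_zeta w x t) (at x within {0..1})"
        by (rule C1_rect_derivs(1)[OF C1 x t])
      show "((\<lambda>s. w x s) has_real_derivative d_time T w x t) (at t within {T - \<delta>..T})"
        by (rule DERIV_subset[OF C1_rect_derivs(2)[OF C1 x t] sub])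
      have "- d_time T w x t + mfg_r c (w x t) x * d_zeta w x t = mfg_q c (w x t) x"
        using w x t unfolding smooth_solution_def by blast
      then show "d_time T w x t = mfg_r c (w x t) x * d_zeta w x t - mfg_q c (w x t) x" by simp
    qed
    have R: "\<bar>w x t\<bar> \<le> M + 2" if "x \<in> {0..1}" "t \<in> {T - \<delta>..T}" for x t
      using abs_bound[OF _ assms(2) Q small(1) Q0 that] M by blast
    show ?thesis
      by (rule abs_slope_le[OF R lip _ assms(3) A _ small(2) x t]) (use L in \<open>auto simp: P_def\<close>)
  qed
  then show ?thesis using \<delta> by blast
qed

text \<open>Choosing \<open>t0\<close> and \<open>C\<close> before \<open>w\<close>, as functions of
  the two quantities, expresses that they depend on the terminal function only through
  these.\<close>

theorem proposition5p1:
  fixes T :: real and c :: "2 \<Rightarrow> real^2 \<Rightarrow> real^2 \<Rightarrow> real"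
  assumes "T > 0" and "running_cost c"
  shows "\<exists>(t0 :: ereal \<Rightarrow> real \<Rightarrow> real) (C :: ereal \<Rightarrow> real \<Rightarrow> real).
    \<forall>w. smooth_solution c T w \<longrightarrow>
      (let M = Linf_norm (\<lambda>\<zeta>. w \<zeta> T); L = lipschitz_const (\<lambda>\<zeta>. w \<zeta> T) in
         t0 M L \<in> {0..<T} \<and>
         (\<forall>t. t0 M L < t \<and> t \<le> T \<longrightarrow>
            Linf_norm (\<lambda>\<zeta>. d_zeta w \<zeta> t) \<le> ereal (C M L / (t - t0 M L))))"
proof -
  interpret running_cost c by fact
  have "\<forall>M L. \<exists>\<delta>. M \<ge> 0 \<longrightarrow> L \<ge> 0 \<longrightarrow> 0 < \<delta> \<and> \<delta> \<le> T \<and>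
    (\<forall>w. smooth_solution c T w \<longrightarrow> (\<forall>x\<in>{0..1}. \<bar>w x T\<bar> \<le> M) \<longrightarrow>
      (\<forall>x\<in>{0..1}. \<forall>y\<in>{0..1}. \<bar>w x T - w y T\<bar> \<le> L * \<bar>x - y\<bar>) \<longrightarrow>
      (\<forall>t\<in>{T - \<delta>..T}. \<forall>x\<in>{0..1}. \<bar>d_zeta w x t\<bar> \<le> L + 2))"
    using short_time_gradient_bound[OF assms(1)] by blast
  then obtain \<delta> where \<delta>: "\<And>M L. M \<ge> 0 \<Longrightarrow> L \<ge> 0 \<Longrightarrow> 0 < \<delta> M L \<and> \<delta> M L \<le> T"
    and bound: "\<And>M L w t x. \<lbrakk>M \<ge> 0; L \<ge> 0; smooth_solution c T w; \<forall>x\<in>{0..1}. \<bar>w x T\<bar> \<le> M;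
      \<forall>x\<in>{0..1}. \<forall>y\<in>{0..1}. \<bar>w x T - w y T\<bar> \<le> L * \<bar>x - y\<bar>; t \<in> {T - \<delta> M L..T}; x \<in> {0..1}\<rbrakk>
      \<Longrightarrow> \<bar>d_zeta w x t\<bar> \<le> L + 2"
    by metis
  define t0 where "t0 M L = T - \<delta> (real_of_ereal M) L" for M L
  \<comment> \<open>Since \<open>t - t0 M L \<le> T\<close>, the uniform bound \<open>L + 2\<close>
    is at most this constant divided by \<open>t - t0 M L\<close>.\<close>
  define C where "C M L = T * (L + 2)" for M :: ereal and L
  have "t0 M L \<in> {0..<T} \<and>
      (\<forall>t. t0 M L < t \<and> t \<le> T \<longrightarrow> Linf_norm (\<lambda>\<zeta>. d_zeta w \<zeta> t) \<le> ereal (C M L / (t - t0 M L)))"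
    if w: "smooth_solution c T w" and M: "M = Linf_norm (\<lambda>\<zeta>. w \<zeta> T)"
      and L: "L = lipschitz_const (\<lambda>\<zeta>. w \<zeta> T)" for w M L
  proof -
    have C1: "C1_rect T w" using w by (simp add: smooth_solution_def)
    have TT: "T \<in> {0..T}" using assms(1) by simp
    obtain B where B: "B \<ge> 0" "\<And>x y t. \<lbrakk>x \<in> {0..1}; y \<in> {0..1}; t \<in> {0..T}\<rbrakk> \<Longrightarrow> \<bar>w x t - w y t\<bar> \<le> B * \<bar>x - y\<bar>"
      by (rule C1_rect_lipschitz[OF C1]) (rule that)
    have lip: "B-lipschitz_on {0..1} (\<lambda>\<zeta>. w \<zeta> T)"
      using B TT by (intro lipschitz_onI) (auto simp: dist_real_def)
    have cont: "continuous_on {0..1} (\<lambda>\<zeta>. w \<zeta> T)" by (rule lipschitz_on_continuous_on[OF lip])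
    have L0: "L \<ge> 0" and LL: "\<forall>x\<in>{0..1}. \<forall>y\<in>{0..1}. \<bar>w x T - w y T\<bar> \<le> L * \<bar>x - y\<bar>"
      using lipschitz_const_bound[OF lip] by (auto simp: L)
    \<comment> \<open>A crude bound making the extended real \<open>M\<close> finite, so that
      \<open>real_of_ereal\<close> in \<open>t0\<close> loses nothing.\<close>
    have "\<bar>w x T\<bar> \<le> \<bar>w 0 T\<bar> + B" if "x \<in> {0..1}" for x
      using B(2)[OF that, of 0 T] TT that mult_left_mono[of "\<bar>x\<bar>" 1 B] B(1) by auto
    then have "M \<le> ereal (\<bar>w 0 T\<bar> + B)" unfolding M by (rule Linf_norm_le[OF cont])
    moreover have le: "ereal \<bar>w x T\<bar> \<le> M" if "x \<in> {0..1}" for x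
      unfolding M by (rule le_Linf_norm[OF cont that])
    ultimately obtain m where m: "M = ereal m"
      using le[of 0] by (cases M) auto
    have MM: "\<forall>x\<in>{0..1}. \<bar>w x T\<bar> \<le> m" using le by (simp add: m)
    then have m0: "m \<ge> 0" by (meson abs_ge_zero atLeastAtMost_iff order_refl order_trans zero_le_one)
    have d: "0 < \<delta> m L" "\<delta> m L \<le> T" using \<delta>[OF m0 L0] by auto
    have "Linf_norm (\<lambda>\<zeta>. d_zeta w \<zeta> t) \<le> ereal (C M L / (t - t0 M L))" if t: "t0 M L < t" "t \<le> T" for t
    proof -
      have tI: "t \<in> {T - \<delta> m L..T}" using t by (simp add: t0_def m)
      then have t0T: "t \<in> {0..T}" using d by auto
      have "continuous_on ({0..1} \<times> {0..T}) (\<lambda>(x, t). d_zeta w x t)"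
        using C1 by (simp add: C1_rect_def)
      then have "continuous_on {0..1} (\<lambda>x. (\<lambda>(x, t). d_zeta w x t) (x, t))"
        by (rule continuous_on_compose2) (use t0T in \<open>auto intro!: continuous_intros\<close>)
      then have c: "continuous_on {0..1} (\<lambda>x. d_zeta w x t)" by simp
      have "Linf_norm (\<lambda>\<zeta>. d_zeta w \<zeta> t) \<le> ereal (L + 2)"
        by (rule Linf_norm_le[OF c bound[OF m0 L0 w MM LL tI]])
      moreover have "(L + 2) * (t - t0 M L) \<le> (L + 2) * T"
        using t d L0 by (intro mult_left_mono) (auto simp: t0_def m)
      then have "L + 2 \<le> C M L / (t - t0 M L)"
        using t by (simp add: C_def le_divide_eq mult.commute)
      ultimately show ?thesis by (meson ereal_less_eq(3) order_trans)
    qed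
    then show ?thesis using d by (auto simp: t0_def m)
  qed
  then show ?thesis unfolding Let_def by blast
qed

end
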